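(* Let $\{X^k\}_{k\ge0}$ be the iterates generated by the algorithm RSSM (described in the context) with stepsizes $\gamma_k \in (0,\frac{1}{L})$ for all $k\ge0$. Then, for any $k\ge0$ and $\lambda \in \bigl(0, \frac{\ell}{2(\tau + (2\ell-1)L)} \bigr)$, conditioning on $X^k$, we have $$\gamma_k \Theta_{\lambda f}^{\mathfrak C}(X^k)^2 = \frac{\gamma_k}{\lambda^2} \|P_{\lambda f}^{\mathfrak C}(X^k)-X^k\|_{\mathcal A_{X^k}^{-1}}^2 \leq \frac{f_\lambda^{\mathfrak C}(X^k) - \mathbb{E}[f^{\mathfrak C}_\lambda(X^{k+1})\,|\,X^k] + \frac{9\gamma_k^2 L^2}{2\lambda} + \frac{2(\ell-2)\gamma_k^3 L^3}{\lambda} + \frac{(\ell-2)\gamma_k^4 L^4}{2\lambda}}{\frac{\lambda}{\ell} \left[\frac{\ell}{2\lambda} - (\tau+(2\ell-3) L)\right]}.$$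
   Context: Let $n\ge p\ge 1$ be integers, $\mathrm{St}(n,p)=\{X\in\mathbb{R}^{n\times p}: X^\top X=I\}$, $[p]=\{1,\dots,p\}$. Matrix spaces carry the Frobenius inner product $\langle\xi,\eta\rangle=\mathrm{tr}(\xi^\top\eta)$ and norm $\|\cdot\|$. Let $f:\mathbb{R}^{n\times p}\to\mathbb{R}$ be $\tau$-weakly convex (i.e. $f(\cdot)+\frac{\tau}{2}\|\cdot\|^2$ is convex) and $L$-Lipschitz continuous on some bounded convex neighborhood $\Omega$ of $\mathrm{St}(n,p)$, where $\tau\ge 0$ and $L>0$. $\partial f$ is the Clarke subdifferential. Column blocks. Let $\mathfrak C=\{C_1,\dots,C_\ell\}$ be a partition of $[p]$ with $\ell\ge 2$; $\binom{[\ell]}{2}$ is the set of unordered pairs of distinct elements of $\{1,\dots,\ell\}$. For $C\subseteq[p]$, $X_C$ is the submatrix of $X$ formed by the columns with indices in $C$; $I_C$ is the corresponding submatrix of the $p\times p$ identity, so $X_C=XI_C$. For $\{i,j\}\in\binom{[\ell]}{2}$ put $C_{ij}=C_i\cup C_j$, $p_{ij}=|C_{ij}|$, $X_{ij}=X_{C_{ij}}$, $I_{ij}=I_{C_{ij}}$, $X_{-ij}=X_{[p]\setminus C_{ij}}$ and, for $X \in \mathrm{St}(n,p)$, $\mathcal M_{X_{-ij}}=\{Y\in\mathrm{St}(n,p_{ij}): X_{-ij}^\top Y=0\}$ (a smooth submanifold), with tangent space $T_{X_{ij}}\mathcal M_{X_{-ij}}=\{\xi\in\mathbb{R}^{n\times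 p_{ij}}:\xi^\top X_{ij}+X_{ij}^\top\xi=0,\ X_{-ij}^\top\xi=0\}$. $\mathcal P_S$ denotes the nearest-point projection onto a set $S$ in the Frobenius norm. Algorithm RSSM. Input: $X^0\in\mathrm{St}(n,p)$ (deterministic), the partition $\mathfrak C$, deterministic stepsizes $\gamma_k\in(0,\frac1L)$. At iteration $k$: a subgradient $\widetilde\nabla f(X^k)\in\partial f(X^k)$ is selected (before the random draw of iteration $k$); a pair $\{i,j\}$ is drawn uniformly from $\binom{[\ell]}{2}$, independently of the past; set $G=\mathcal P_{T_{X^k_{ij}}\mathcal M_{X^k_{-ij}}}(\widetilde\nabla f(X^k)I_{ij})$; and update $X^{k+1}_{ij}=\mathcal P_{\mathcal M_{X^k_{-ij}}}(X^k_{ij}-\gamma_k G)=\mathcal P_{\mathrm{St}(n,p_{ij})}(X^k_{ij}-\gamma_kG)$ (these projections are unique and equal), $X^{k+1}_{-ij}=X^k_{-ij}$. Averaging operator. For $X\in\mathrm{St}(n,p)$, $\mathcal A_X:\mathbb{R}^{n\times p}\to\mathbb{R}^{n\times p}$ is the linear operator $\mathcal A_X(\xi)=\binom{\ell}{2}^{-1}\sum_{\{i,j\}\in\binom{[\ell]}{2}}(I-X_{-ij}X_{-ij}^\top)\xi_{ij}I_{ij}^\top$, with $\xi_{ij}=\xi I_{ij}$. It is self-adjoint and positive definite; $\|\xi\|_{\mathcal A_X^{-1}}=\sqrt{\langle\mathcal A_X^{-1}(\xi),\xi\rangle}$. For $X\in\mathrm{St}(n,p)$: $f_\lambda^{\mathfrak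 C}(X)=\min_{Y\in\mathrm{St}(n,p)}\{f(Y)+\frac1{2\lambda}\|Y-X\|_{\mathcal A_X^{-1}}^2\}$, $P_{\lambda f}^{\mathfrak C}(X)=\mathrm{argmin}_{Y\in\mathrm{St}(n,p)}\{f(Y)+\frac1{2\lambda}\|Y-X\|_{\mathcal A_X^{-1}}^2\}$ (single-valued for $\lambda$ in the range considered), $\Theta_{\lambda f}^{\mathfrak C}(X)=\frac1\lambda\|P_{\lambda f}^{\mathfrak C}(X)-X\|_{\mathcal A_X^{-1}}$. *)

theory Defs
  imports "HOL-Probability.Probability"
begin

section \<open>Matrices and column blocks\<close>

text \<open>
  An \<open>n \<times> p\<close> matrix is an element of \<open>real ^ 'p ^ 'n\<close>, with \<open>n = CARD('n)\<close>, \<open>p = CARD('p)\<close> and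
  columns indexed by \<open>'p\<close>. The inner product and norm of this type are the Frobenius ones:
\<close>

lemma frobenius_inner: "A \<bullet> B = trace (transpose A ** B)" for A B :: "real ^ 'p ^ 'n"
proof -
  have "trace (transpose A ** B) = (\<Sum>j\<in>UNIV. \<Sum>i\<in>UNIV. A $ i $ j * B $ i $ j)"
    by (simp add: trace_def matrix_matrix_mult_def transpose_def)
  also have "\<dots> = A \<bullet> B"
    by (subst sum.swap) (simp add: inner_vec_def)
  finally show ?thesis ..
qed

text \<open>
  The number of columns of a submatrix depends on the block, so it cannot be a type. For a set \<open>C\<close>
  of column indices, the space of \<open>n \<times> card C\<close> matrices is identified, isometrically, with the
  space of \<open>n \<times> p\<close> matrices whose columns outside \<open>C\<close> vanish. Under this identification (padding by
  zero columns) \<open>I\<^sub>C\<close> is the diagonal matrix below, \<open>X\<^sub>C\<close> is \<open>X I\<^sub>C\<close>, and the identity matrix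
  of size \<open>card C\<close> is \<open>I\<^sub>C\<close>.
\<close>

definition sel :: "'p set \<Rightarrow> real ^ 'p ^ 'p"
  where "sel C = (\<chi> i j. if i = j \<and> j \<in> C then 1 else 0)"

definition cols :: "real ^ 'p ^ 'n \<Rightarrow> 'p set \<Rightarrow> real ^ 'p ^ 'n"
  where "cols X C = X ** sel C"

definition stiefel :: "(real ^ 'p ^ 'n) set"
  where "stiefel = {X. transpose X ** X = mat 1}"

text \<open>\<open>St(n, card C)\<close>, padded:\<close>

definition stiefel_on :: "'p set \<Rightarrow> (real ^ 'p ^ 'n) set"
  where "stiefel_on C = {Y. cols Y C = Y \<and> transpose Y ** Y = sel C}"

lemma stiefel_on_image:
  fixes \<sigma> :: "'m::finite \<Rightarrow> 'p::finite"
  assumes "inj \<sigma>" and "range \<sigma> = C"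
  defines "J \<equiv> (\<chi> i a. if i = \<sigma> a then 1 else 0) :: real ^ 'm ^ 'p"
  shows "stiefel_on C = (\<lambda>Y. Y ** transpose J) ` (stiefel :: (real ^ 'm ^ 'n) set)"
proof -
  have JtJ: "transpose J ** J = mat 1"
  proof -
    have "(\<Sum>i\<in>UNIV. J $ i $ a * J $ i $ b) = (\<Sum>i\<in>UNIV. if i = \<sigma> a then (if a = b then 1 else 0) else 0)"
      for a b
      using assms(1) by (intro sum.cong) (auto simp: J_def inj_def)
    then show ?thesis
      by (simp add: vec_eq_iff matrix_matrix_mult_def transpose_def mat_def)
  qed
  have JJt: "J ** transpose J = sel C"
  proof -
    have "(\<Sum>a\<in>UNIV. J $ i $ a * J $ j $ a) = sel C $ i $ j" for i j
    proof (cases "i \<in> C \<and> i = j")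
      case True
      then obtain b where b: "i = \<sigma> b" using assms(2) by auto
      have "(\<Sum>a\<in>UNIV. J $ i $ a * J $ j $ a) = (\<Sum>a\<in>UNIV. if a = b then 1 else 0)"
        using True b assms(1) by (intro sum.cong) (auto simp: J_def inj_def)
      then show ?thesis using True by (auto simp: sel_def)
    next
      case False
      then have "J $ i $ a * J $ j $ a = 0" for a
        using assms(2) by (auto simp: J_def)
      then have "(\<Sum>a\<in>UNIV. J $ i $ a * J $ j $ a) = 0" by (intro sum.neutral) blast
      then show ?thesis using False by (auto simp: sel_def)
    qed
    then show ?thesis
      by (simp add: vec_eq_iff matrix_matrix_mult_def transpose_def)
  qed
  show ?thesis
  proof (intro equalityI subsetI)
    fix Y :: "real ^ 'p ^ 'n" assume "Y \<in> stiefel_on C"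
    then have 1: "Y ** sel C = Y" and 2: "transpose Y ** Y = sel C"
      by (auto simp: stiefel_on_def cols_def)
    have "transpose (Y ** J) ** (Y ** J) = transpose J ** (transpose Y ** Y) ** J"
      by (simp add: matrix_transpose_mul matrix_mul_assoc)
    also have "\<dots> = (transpose J ** J) ** (transpose J ** J)"
      by (simp only: 2 JJt[symmetric] matrix_mul_assoc)
    finally have "Y ** J \<in> stiefel" by (simp add: stiefel_def JtJ)
    moreover have "Y = (Y ** J) ** transpose J"
      using 1 JJt by (simp add: matrix_mul_assoc[symmetric])
    ultimately show "Y \<in> (\<lambda>Y. Y ** transpose J) ` stiefel" by blast
  next
    fix Y :: "real ^ 'p ^ 'n" assume "Y \<in> (\<lambda>Y. Y ** transpose J) ` stiefel"
    then obtain Z :: "real ^ 'm ^ 'n" where Z: "transpose Z ** Z = mat 1" "Y = Z ** transpose J"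
      by (auto simp: stiefel_def)
    have "Y ** sel C = Z ** (transpose J ** J) ** transpose J"
      by (simp only: Z(2) JJt[symmetric] matrix_mul_assoc)
    then have "Y ** sel C = Y" by (simp add: JtJ Z(2))
    moreover have "transpose Y ** Y = J ** (transpose Z ** Z) ** transpose J"
      by (simp add: Z(2) matrix_transpose_mul matrix_mul_assoc)
    then have "transpose Y ** Y = sel C" by (simp add: Z(1) JJt)
    ultimately show "Y \<in> stiefel_on C" by (simp add: stiefel_on_def cols_def)
  qed
qed

text \<open>
  In the next two definitions \<open>C\<close> plays the role of \<open>C\<^sub>i\<^sub>j\<close>, so that
  \<open>cols X C\<close> is \<open>X\<^sub>i\<^sub>j\<close> and \<open>cols X (- C)\<close> is \<open>X\<close> without these columns.
\<close>

definition block_manifold :: "real ^ 'p ^ 'n \<Rightarrow> 'p set \<Rightarrow> (real ^ 'p ^ 'n) set"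
  where "block_manifold X C = {Y \<in> stiefel_on C. transpose (cols X (- C)) ** Y = 0}"

definition block_tangent :: "real ^ 'p ^ 'n \<Rightarrow> 'p set \<Rightarrow> (real ^ 'p ^ 'n) set"
  where "block_tangent X C = {\<xi>. cols \<xi> C = \<xi>
    \<and> transpose \<xi> ** cols X C + transpose (cols X C) ** \<xi> = 0
    \<and> transpose (cols X (- C)) ** \<xi> = 0}"

text \<open>
  For a partition \<open>\<CC>\<close>, an unordered pair \<open>{i, j}\<close> of block indices is represented by the
  two-element set \<open>e = {C\<^sub>i, C\<^sub>j}\<close> of blocks; then \<open>C\<^sub>i\<^sub>j = \<Union>e\<close>.
\<close>

definition block_pairs :: "'p set set \<Rightarrow> 'p set set set"
  where "block_pairs \<CC> = {e. e \<subseteq> \<CC> \<and> card e = 2}"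


section \<open>Clarke subdifferential\<close>

definition clarke_derivative :: "('a::real_inner \<Rightarrow> real) \<Rightarrow> 'a \<Rightarrow> 'a \<Rightarrow> ereal"
  where "clarke_derivative f x v =
    Limsup (nhds x \<times>\<^sub>F at_right 0) (\<lambda>(y, t). ereal ((f (y + t *\<^sub>R v) - f y) / t))"

definition clarke_subdifferential :: "('a::real_inner \<Rightarrow> real) \<Rightarrow> 'a \<Rightarrow> 'a set"
  where "clarke_subdifferential f x = {g. \<forall>v. ereal (g \<bullet> v) \<le> clarke_derivative f x v}"


section \<open>Averaging operator and the associated envelope\<close>

definition avg_op :: "'p set set \<Rightarrow> real ^ 'p ^ 'n \<Rightarrow> real ^ 'p ^ 'n \<Rightarrow> real ^ 'p ^ 'n"
  where "avg_op \<CC> X \<xi> = (1 / real (card \<CC> choose 2)) *\<^sub>R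
    (\<Sum>e\<in>block_pairs \<CC>. (mat 1 - cols X (- \<Union>e) ** transpose (cols X (- \<Union>e)))
        ** cols \<xi> (\<Union>e) ** transpose (sel (\<Union>e)))"

definition avg_inv_norm :: "'p set set \<Rightarrow> real ^ 'p ^ 'n \<Rightarrow> real ^ 'p ^ 'n \<Rightarrow> real"
  where "avg_inv_norm \<CC> X \<xi> = sqrt (inv (avg_op \<CC> X) \<xi> \<bullet> \<xi>)"

definition prox_objective ::
    "(real ^ 'p ^ 'n \<Rightarrow> real) \<Rightarrow> 'p set set \<Rightarrow> real \<Rightarrow> real ^ 'p ^ 'n \<Rightarrow> real ^ 'p ^ 'n \<Rightarrow> real"
  where "prox_objective f \<CC> lam X Y = f Y + 1 / (2 * lam) * (avg_inv_norm \<CC> X (Y - X))\<^sup>2"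

definition envelope ::
    "(real ^ 'p ^ 'n \<Rightarrow> real) \<Rightarrow> 'p set set \<Rightarrow> real \<Rightarrow> real ^ 'p ^ 'n \<Rightarrow> real"
  where "envelope f \<CC> lam X = (INF Y\<in>stiefel. prox_objective f \<CC> lam X Y)"

definition prox ::
    "(real ^ 'p ^ 'n \<Rightarrow> real) \<Rightarrow> 'p set set \<Rightarrow> real \<Rightarrow> real ^ 'p ^ 'n \<Rightarrow> real ^ 'p ^ 'n"
  where "prox f \<CC> lam X = arg_min_on (prox_objective f \<CC> lam X) stiefel"

definition stationarity_measure ::
    "(real ^ 'p ^ 'n \<Rightarrow> real) \<Rightarrow> 'p set set \<Rightarrow> real \<Rightarrow> real ^ 'p ^ 'n \<Rightarrow> real"
  where "stationarity_measure f \<CC> lam X = 1 / lam * avg_inv_norm \<CC> X (prox f \<CC> lam X - X)"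


section \<open>The randomized submanifold subgradient method\<close>

text \<open>
  One iteration from \<open>X\<close> to \<open>X'\<close> with subgradient \<open>D\<close>, drawn pair \<open>e\<close> and stepsize \<open>\<gamma>\<close>.
  \<^const>\<open>closest_point\<close> is the nearest-point projection; on the (nonconvex) manifold it is applied
  only at points with a unique nearest point.
\<close>

definition rssm_step ::
    "real \<Rightarrow> 'p set set \<Rightarrow> real ^ 'p ^ 'n \<Rightarrow> real ^ 'p ^ 'n \<Rightarrow> real ^ 'p ^ 'n \<Rightarrow> bool"
  where "rssm_step \<gamma> e D X X' \<longleftrightarrow>
    (let C = \<Union>e; G = closest_point (block_tangent X C) (D ** sel C)
     in cols X' C = closest_point (block_manifold X C) (cols X C - \<gamma> *\<^sub>R G)
        \<and> cols X' (- C) = cols X (- C))"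

text \<open>
  A run on the probability space \<open>M\<close>: \<open>X k\<close> is the \<open>k\<close>-th iterate, \<open>D k\<close> the selected
  subgradient and \<open>E k\<close> the drawn pair. \<open>\<F> k\<close> is the information available just before the draw of
  iteration \<open>k\<close>: it contains \<open>X i\<close>, \<open>D i\<close> for \<open>i \<le> k\<close> and \<open>E i\<close> for \<open>i < k\<close>.
\<close>

definition rssm_run ::
    "'w measure \<Rightarrow> (nat \<Rightarrow> 'w measure) \<Rightarrow> (real ^ 'p ^ 'n \<Rightarrow> real) \<Rightarrow> 'p set set \<Rightarrow>
     (nat \<Rightarrow> real) \<Rightarrow> real ^ 'p ^ 'n \<Rightarrow> (nat \<Rightarrow> 'w \<Rightarrow> real ^ 'p ^ 'n) \<Rightarrow>
     (nat \<Rightarrow> 'w \<Rightarrow> real ^ 'p ^ 'n) \<Rightarrow> (nat \<Rightarrow> 'w \<Rightarrow> 'p set set) \<Rightarrow> bool"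
  where "rssm_run M \<F> f \<CC> \<gamma> X0 X D E \<longleftrightarrow>
    prob_space M \<and> filtration (space M) \<F> \<and> (\<forall>k. subalgebra M (\<F> k)) \<and>
    (\<forall>k. X k \<in> borel_measurable (\<F> k)) \<and>
    (\<forall>k. D k \<in> borel_measurable (\<F> k)) \<and>
    (\<forall>k. E k \<in> measurable (\<F> (Suc k)) (count_space (block_pairs \<CC>))) \<and>
    (\<forall>k. distr M (count_space (block_pairs \<CC>)) (E k) = uniform_count_measure (block_pairs \<CC>)) \<and>
    (\<forall>k. prob_space.indep_set M
           (sets (vimage_algebra (space M) (E k) (count_space (block_pairs \<CC>)))) (sets (\<F> k))) \<and>
    (\<forall>\<omega>\<in>space M. X 0 \<omega> = X0 \<and>
       (\<forall>k. D k \<omega> \<in> clarke_subdifferential f (X k \<omega>) \<and>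
            rssm_step (\<gamma> k) (E k \<omega>) (D k \<omega>) (X k \<omega>) (X (Suc k) \<omega>)))"

end

theory Submission
  imports Defs
begin

text \<open>
  Let \<open>W = prox X\<close> and let \<open>\<parallel>\<xi>\<parallel>\<^sub>X\<close> be the norm of \<open>\<A>\<^sub>X\<^sup>-\<^sup>1\<close>. Since \<open>W\<close> is admissible for the envelope at
  \<open>X\<^sup>+\<close>, it suffices to estimate the mean of \<open>\<parallel>W - X\<^sup>+\<parallel>\<^sup>2\<close> in the metric at \<open>X\<^sup>+\<close>. On the Stiefel
  manifold \<open>\<parallel>W - X\<parallel>\<^sub>X\<^sup>2 = l/2 (\<parallel>W - X\<parallel>\<^sup>2 + (l - 2) \<parallel>off (X\<^sup>T W)\<parallel>\<^sup>2)\<close>, where \<open>off\<close> keeps the off-diagonal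
  blocks, so the change of the metric along a step can be controlled explicitly. The mean step direction is \<open>\<A>\<^sub>X\<close>
  applied to the Riemannian subgradient, so the first-order term is the inner product of the subgradient
  with \<open>W - X\<close> up to a curvature error, and weak convexity together with the minimality of \<open>W\<close> bounds it.
  The projection is the polar factor of a matrix \<open>Y\<close> with \<open>Y\<^sup>T Y \<ge> I\<close>. Hence it is nonexpansive
  towards Stiefel matrices and differs from \<open>Y\<close> only to second order.
\<close>

section \<open>Frobenius geometry\<close>

text \<open>The trial point \<open>X - \<gamma> G\<close> has Gram matrix
  \<open>I + \<gamma>^2 G^T G\<close>, because \<open>X^T G\<close> is skew for a tangent
  \<open>G\<close>; this is where \<open>Y^T Y >= I\<close> comes from. The formula for the metric
  comes from counting: two column indices in one block are covered together by \<open>l - 1\<close>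
  pairs, two in different blocks by a single pair. So the averaging operator is a multiple of the
  identity minus a multiple of the orthogonal projection \<open>\<xi> -> X off (X^T \<xi>)\<close>,
  and it can be inverted by hand. Since \<open>off (Z^T Z) = 0\<close>, the off-diagonal part of the
  metric at \<open>Z\<close> depends on \<open>off (Z^T W)\<close> only, which is linear in
  \<open>Z\<close>. The factor \<open>2 l - 3\<close> is \<open>1 + (l - 2) (1/2 + 3/2)\<close>: one
  curvature term, and \<open>l - 2\<close> times two terms caused by the moving metric. On the
  probabilistic side, the subgradient need not be a function of the current iterate, and
  \<open>prox\<close> is a choice among minimisers. Hence the mean over the pairs is computed given
  \<open>\<F> k\<close> and compared with a bound that depends measurably on \<open>X k\<close>
  alone, before conditioning on \<open>X k\<close>.\<close>

lemma inner_matrix_mult_left: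
  fixes A :: "real ^ 'm ^ 'n" and B :: "real ^ 'k ^ 'm"
  shows "(A ** B) \<bullet> C = B \<bullet> (transpose A ** C)"
  by (simp add: frobenius_inner matrix_transpose_mul matrix_mul_assoc)

lemma inner_transpose: "transpose A \<bullet> transpose B = A \<bullet> B" for A B :: "real ^ 'm ^ 'n"
  unfolding inner_vec_def transpose_def by simp (rule sum.swap)

lemma inner_matrix_mult_right:
  fixes A :: "real ^ 'm ^ 'n" and B :: "real ^ 'k ^ 'm"
  shows "(A ** B) \<bullet> C = A \<bullet> (C ** transpose B)"
proof -
  have "(A ** B) \<bullet> C = (transpose B ** transpose A) \<bullet> transpose C"
    by (metis inner_transpose matrix_transpose_mul)
  also have "\<dots> = transpose A \<bullet> (B ** transpose C)"
    by (simp add: inner_matrix_mult_left)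
  also have "\<dots> = A \<bullet> (C ** transpose B)"
    by (metis inner_transpose matrix_transpose_mul transpose_transpose)
  finally show ?thesis .
qed

lemma norm_transpose [simp]: "norm (transpose A) = norm A" for A :: "real ^ 'm ^ 'n"
  by (simp add: norm_eq_sqrt_inner inner_transpose)

lemma norm_matrix_power2: "(norm A)\<^sup>2 = (\<Sum>i\<in>UNIV. \<Sum>j\<in>UNIV. (A $ i $ j)\<^sup>2)" for A :: "real ^ 'm ^ 'n"
  unfolding power2_norm_eq_inner inner_vec_def by (simp add: power2_eq_square)

lemma norm_matrix_mult_le:
  fixes A :: "real ^ 'm ^ 'n" and B :: "real ^ 'k ^ 'm"
  shows "norm (A ** B) \<le> norm A * norm B"
proof (rule power2_le_imp_le)
  have *: "((A ** B) $ i $ j)\<^sup>2 \<le> (norm (A $ i))\<^sup>2 * (norm (transpose B $ j))\<^sup>2" for i j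
  proof -
    have "(A ** B) $ i $ j = A $ i \<bullet> transpose B $ j"
      by (simp add: matrix_matrix_mult_def inner_vec_def transpose_def)
    then show ?thesis
      by (metis Cauchy_Schwarz_ineq power2_norm_eq_inner)
  qed
  have "(norm (A ** B))\<^sup>2 \<le> (\<Sum>i\<in>UNIV. \<Sum>j\<in>UNIV. (norm (A $ i))\<^sup>2 * (norm (transpose B $ j))\<^sup>2)"
    unfolding norm_matrix_power2 by (intro sum_mono *)
  also have "\<dots> = (\<Sum>i\<in>UNIV. (norm (A $ i))\<^sup>2) * (\<Sum>j\<in>UNIV. (norm (transpose B $ j))\<^sup>2)"
    by (simp add: sum_product)
  also have "\<dots> = (norm A)\<^sup>2 * (norm (transpose B))\<^sup>2"
    by (simp add: power2_norm_eq_inner inner_vec_def[of A A] inner_vec_def[of "transpose B" "transpose B"] del: norm_transpose)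
  finally show "(norm (A ** B))\<^sup>2 \<le> (norm A * norm B)\<^sup>2"
    by (simp add: power_mult_distrib)
qed simp

text \<open>Supplies distributivity, sums and continuity of matrix products from the theory of
  bounded bilinear maps; the algebraic rules are collected in \<open>mat_distrib\<close>.\<close>

interpretation matmul: bounded_bilinear "(**) :: real ^ 'm ^ 'n \<Rightarrow> real ^ 'k ^ 'm \<Rightarrow> real ^ 'k ^ 'n"
proof
  show "\<exists>K. \<forall>(a::real ^ 'm ^ 'n) (b::real ^ 'k ^ 'm). norm (a ** b) \<le> norm a * norm b * K"
    using norm_matrix_mult_le by (intro exI[of _ 1]) auto
qed (simp_all add: matrix_add_ldistrib matrix_scalar_ac scalar_matrix_assoc,
     simp_all add: vec_eq_iff matrix_matrix_mult_def sum.distrib algebra_simps)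

lemma linear_transpose: "linear (transpose :: real ^ 'm ^ 'n \<Rightarrow> real ^ 'n ^ 'm)"
  by (rule linearI) (simp_all add: vec_eq_iff transpose_def)

lemmas continuous_on_transpose [continuous_intros] =
  bounded_linear.continuous_on[OF linear_transpose[unfolded linear_conv_bounded_linear]]

lemmas mat_distrib = matmul.diff_left matmul.diff_right matmul.add_left matmul.add_right
  matmul.scaleR_left matmul.scaleR_right matmul.minus_left matmul.minus_right
  linear_diff[OF linear_transpose] linear_add[OF linear_transpose]
  linear_cmul[OF linear_transpose] linear_neg[OF linear_transpose]

lemma inner_matrix_vector: "(A *v x) \<bullet> y = x \<bullet> (transpose A *v y)" for A :: "real ^ 'm ^ 'n"
  by (metis dot_lmul_matrix inner_commute transpose_matrix_vector)

lemma norm_isometry_mult: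
  fixes W :: "real ^ 'p ^ 'n" and A :: "real ^ 'k ^ 'p"
  assumes "W \<in> stiefel" shows "norm (W ** A) = norm A"
  using assms by (simp add: norm_eq_sqrt_inner inner_matrix_mult_left matrix_mul_assoc stiefel_def)

text \<open>Multiplication by \<open>W\<close> on the left is isometric, so its adjoint,
  multiplication by \<open>W^T\<close>, is a contraction. Transposing gives the form below.\<close>

lemma norm_mult_transpose_stiefel_le:
  fixes W :: "real ^ 'p ^ 'n" and A :: "real ^ 'k ^ 'n"
  assumes "W \<in> stiefel" shows "norm (transpose A ** W) \<le> norm A"
proof -
  have "norm (transpose W ** A) \<le> norm A"
  proof (cases "transpose W ** A = 0")
    case False
    have "(norm (transpose W ** A))\<^sup>2 = (W ** (transpose W ** A)) \<bullet> A"
      by (simp add: power2_norm_eq_inner inner_matrix_mult_left)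
    also have "\<dots> \<le> norm (transpose W ** A) * norm A"
      using norm_cauchy_schwarz[of "W ** (transpose W ** A)" A] norm_isometry_mult[OF assms, of "transpose W ** A"] by simp
    finally show ?thesis using False by (simp add: power2_eq_square)
  qed simp
  then show ?thesis by (metis matrix_transpose_mul norm_transpose transpose_transpose)
qed

lemma norm_stiefel: "norm W = sqrt (real CARD('p))" if "W \<in> stiefel" for W :: "real ^ 'p ^ 'n"
proof -
  have "(norm W)\<^sup>2 = real CARD('p)"
    using that by (simp add: power2_norm_eq_inner frobenius_inner stiefel_def trace_def mat_def)
  then show ?thesis by (metis norm_ge_zero real_sqrt_unique)
qed

lemma compact_stiefel: "compact (stiefel :: (real ^ 'p ^ 'n) set)"
proof -
  have "closed {X :: real ^ 'p ^ 'n. transpose X ** X = mat 1}"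
    by (intro closed_Collect_eq matmul.continuous_on continuous_intros)
  moreover have "bounded (stiefel :: (real ^ 'p ^ 'n) set)"
    by (auto simp: bounded_iff norm_stiefel)
  ultimately show ?thesis by (simp add: compact_eq_bounded_closed stiefel_def)
qed


section \<open>Polar factors\<close>

definition psd :: "real ^ 'n ^ 'n \<Rightarrow> bool"
  where "psd K \<longleftrightarrow> transpose K = K \<and> (\<forall>x. 0 \<le> x \<bullet> (K *v x))"

text \<open>The inner product is the trace of \<open>V J V^T\<close>, a sum of values of the form
  \<open>J\<close> at the rows of \<open>V\<close>.\<close>

lemma psd_inner_nonneg:
  fixes V :: "real ^ 'p ^ 'n"
  assumes "psd J" shows "0 \<le> J \<bullet> (transpose V ** V)"
proof -
  have "J \<bullet> (transpose V ** V) = (V ** J) \<bullet> V"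
    by (metis inner_commute inner_matrix_mult_left transpose_transpose)
  also have "\<dots> = (\<Sum>i\<in>UNIV. V $ i \<bullet> (J *v V $ i))"
  proof -
    have "(V ** J) $ i = J *v V $ i" for i
    proof -
      have "(V ** J) $ i = transpose J *v V $ i"
        by (simp add: vec_eq_iff matrix_matrix_mult_def vector_matrix_mult_def mult.commute)
      then show ?thesis using assms by (simp add: psd_def del: transpose_matrix_vector)
    qed
    then show ?thesis by (subst inner_commute) (simp add: inner_vec_def[of V])
  qed
  also have "\<dots> \<ge> 0" using assms by (intro sum_nonneg) (simp add: psd_def)
  finally show ?thesis .
qed

lemma psd_cauchy_schwarz:
  assumes "psd K" shows "(a \<bullet> (K *v b))\<^sup>2 \<le> (a \<bullet> (K *v a)) * (b \<bullet> (K *v b))"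
proof -
  have s: "b \<bullet> (K *v a) = a \<bullet> (K *v b)"
    using assms by (metis inner_commute inner_matrix_vector psd_def)
  have q: "0 \<le> a \<bullet> (K *v a) + 2 * t * (a \<bullet> (K *v b)) + t\<^sup>2 * (b \<bullet> (K *v b))" for t
  proof -
    have "0 \<le> (a + t *\<^sub>R b) \<bullet> (K *v (a + t *\<^sub>R b))" using assms by (simp add: psd_def)
    also have "\<dots> = a \<bullet> (K *v a) + 2 * t * (a \<bullet> (K *v b)) + t\<^sup>2 * (b \<bullet> (K *v b))"
      by (simp add: matrix_vector_right_distrib matrix_vector_mult_scaleR inner_add_left inner_add_right s
          power2_eq_square algebra_simps)
    finally show ?thesis .
  qed
  define A B C where "A = a \<bullet> (K *v a)" and "B = a \<bullet> (K *v b)" and "C = b \<bullet> (K *v b)"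
  have C0: "C \<ge> 0" using assms by (simp add: psd_def C_def)
  have q': "0 \<le> A + 2 * t * B + t\<^sup>2 * C" for t using q by (simp add: A_def B_def C_def)
  have "B\<^sup>2 \<le> A * C"
  proof (cases "C = 0")
    case True
    have "B = 0"
    proof (rule ccontr)
      assume "B \<noteq> 0"
      \<comment> \<open>If the form vanishes at \<open>b\<close>, the quadratic in \<open>t\<close>
        is affine and nonnegative everywhere. At this \<open>t\<close> it would equal -1.\<close>
      then show False using q'[of "- (A + 1) / (2 * B)"] True by (simp add: field_simps)
    qed
    then show ?thesis using True by simp
  next
    case False
    then show ?thesis using q'[of "- B / C"] C0
      by (simp add: field_simps power2_eq_square)
  qed
  then show ?thesis by (simp add: A_def B_def C_def)
qed

text \<open>Operator monotonicity of the square root at the identity: the Cauchy--Schwarz inequality of the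
  form \<open>K\<close>, applied to \<open>x\<close> and \<open>K\<^sup>-\<^sup>1 x\<close>, replaces the spectral theorem.\<close>

lemma psd_sqrt_ge_one:
  fixes K :: "real ^ 'p ^ 'p" and G :: "real ^ 'p ^ 'n"
  assumes K: "psd K" and sq: "K ** K = mat 1 + transpose G ** G"
  shows "psd (K - mat 1)" and "2 * norm (K - mat 1) \<le> (norm G)\<^sup>2"
proof -
  \<comment> \<open>\<open>K^2 >= I\<close> makes \<open>K\<close> expanding, hence invertible; this
    yields the preimage \<open>z\<close> of \<open>x\<close> used below.\<close>
  have nK: "norm x \<le> norm (K *v x)" for x
  proof -
    have "(norm (K *v x))\<^sup>2 = x \<bullet> ((K ** K) *v x)"
      using K by (simp add: power2_norm_eq_inner inner_matrix_vector matrix_vector_mul_assoc psd_def del: transpose_matrix_vector)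
    also have "\<dots> = (norm x)\<^sup>2 + (norm (G *v x))\<^sup>2"
      by (simp add: sq power2_norm_eq_inner inner_matrix_vector[of G] matrix_vector_mult_add_rdistrib inner_add_right
          matrix_vector_mul_assoc del: transpose_matrix_vector)
    finally show ?thesis by (simp add: power2_le_imp_le)
  qed
  have "inj ((*v) K)"
    using nK by (intro linear_injective_0[THEN iffD2]) (auto, metis norm_le_zero_iff norm_zero)
  then have surj: "surj ((*v) K)"
    by (intro linear_injective_imp_surjective) auto
  have "x \<bullet> x \<le> x \<bullet> (K *v x)" for x
  proof (cases "x = 0")
    case False
    obtain z where z: "x = K *v z" using surj by (metis surjD)
    have "(x \<bullet> x)\<^sup>2 \<le> (x \<bullet> (K *v x)) * (z \<bullet> x)"
      using psd_cauchy_schwarz[OF K, of x z] z by simp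
    also have "\<dots> \<le> (x \<bullet> (K *v x)) * (x \<bullet> x)"
    proof (rule mult_left_mono)
      have "z \<bullet> x \<le> norm z * norm x" by (rule norm_cauchy_schwarz)
      also have "\<dots> \<le> norm x * norm x" using nK[of z] z by (simp add: mult_right_mono)
      finally show "z \<bullet> x \<le> x \<bullet> x" by (simp add: power2_norm_eq_inner flip: power2_eq_square)
    qed (use K in \<open>simp add: psd_def\<close>)
    finally show ?thesis using False by (simp add: power2_eq_square)
  qed simp
  then show J: "psd (K - mat 1)"
    using K by (simp add: psd_def matrix_vector_mult_diff_rdistrib inner_diff_right mat_distrib)
  define J where "J = K - mat 1"
  have J': "psd J" using J by (simp add: J_def)
  have JJ: "J ** J + 2 *\<^sub>R J = transpose G ** G"
    using sq by (simp add: J_def mat_distrib scaleR_2 algebra_simps)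
  \<comment> \<open>Pairing \<open>J^2 + 2 J = G^T G\<close> with \<open>J\<close> and dropping the
    nonnegative cubic term leaves a quadratic bound in \<open>norm J\<close>, from which one factor
    cancels.\<close>
  have "2 * (norm J)\<^sup>2 \<le> J \<bullet> (transpose J ** J) + 2 * (norm J)\<^sup>2"
    using psd_inner_nonneg[OF J', of J] by simp
  also have "\<dots> = J \<bullet> (transpose G ** G)"
    using J' by (simp add: JJ[symmetric] inner_add_right power2_norm_eq_inner psd_def)
  also have "\<dots> \<le> norm J * (norm G * norm G)"
    by (meson norm_cauchy_schwarz order_trans mult_left_mono norm_ge_zero norm_matrix_mult_le[of "transpose G" G, simplified])
  finally show "2 * norm (K - mat 1) \<le> (norm G)\<^sup>2"
    unfolding J_def[symmetric] power2_eq_square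
    by (cases "J = 0") (auto simp: mult.assoc mult.left_commute)
qed

text \<open>A Stiefel matrix satisfying the following strengthened projection inequality behaves like a
  projection onto a convex set.\<close>

definition strong_proj :: "real ^ 'p ^ 'n \<Rightarrow> real ^ 'p ^ 'n \<Rightarrow> bool"
  where "strong_proj Y Z \<longleftrightarrow> Z \<in> stiefel \<and>
    (\<forall>B\<in>stiefel. (norm (Y - Z))\<^sup>2 + (norm (Z - B))\<^sup>2 \<le> (norm (Y - B))\<^sup>2)"

lemma strong_proj_self: "Z \<in> stiefel \<Longrightarrow> strong_proj Z Z"
  by (simp add: strong_proj_def)

text \<open>As for convex sets: test each projection inequality with the other projected point and
  add. The cross terms give \<open>norm (Z1 - Z2)\<close> squared at most the inner product of
  \<open>Y1 - Y2\<close> with \<open>Z1 - Z2\<close>.\<close>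

lemma strong_proj_nonexpansive:
  assumes "strong_proj Y1 Z1" "strong_proj Y2 Z2"
  shows "norm (Z1 - Z2) \<le> norm (Y1 - Y2)"
proof (cases "Z1 = Z2")
  case False
  have "(norm (Y1 - Z1))\<^sup>2 + (norm (Z1 - Z2))\<^sup>2 \<le> (norm (Y1 - Z2))\<^sup>2"
       "(norm (Y2 - Z2))\<^sup>2 + (norm (Z2 - Z1))\<^sup>2 \<le> (norm (Y2 - Z1))\<^sup>2"
    using assms by (auto simp: strong_proj_def)
  then have "(Z1 - Z2) \<bullet> (Z1 - Z2) \<le> (Y1 - Y2) \<bullet> (Z1 - Z2)"
    by (simp add: power2_norm_eq_inner inner_diff_left inner_diff_right inner_commute)
  also have "\<dots> \<le> norm (Y1 - Y2) * norm (Z1 - Z2)" by (rule norm_cauchy_schwarz)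
  finally show ?thesis using False
    by (simp add: power2_norm_eq_inner[symmetric] power2_eq_square)
qed simp

text \<open>\<open>Z\<close> and \<open>B\<close> have the same Gram matrix, so twice the cross
  term, which convexity would make nonnegative, equals the pairing of \<open>K - I\<close> with the
  Gram matrix of \<open>Z - B\<close>. Its sign is therefore decided by
  \<open>K >= I\<close>.\<close>

lemma strong_proj_polar:
  fixes Z :: "real ^ 'p ^ 'n"
  assumes Z: "Z \<in> stiefel" and Y: "Y = Z ** K" and J: "psd (K - mat 1)"
  shows "strong_proj Y Z"
  unfolding strong_proj_def
proof (intro conjI ballI)
  fix B :: "real ^ 'p ^ 'n" assume B: "B \<in> stiefel"
  define J where "J = K - mat 1"
  define V where "V = Z - B"
  have YZ: "Y - Z = Z ** J" by (simp add: Y J_def mat_distrib)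
  have tJ: "transpose J = J" using assms by (simp add: psd_def J_def)
  have "(norm (Y - B))\<^sup>2 = (norm (Y - Z))\<^sup>2 + 2 * ((Y - Z) \<bullet> (Z - B)) + (norm (Z - B))\<^sup>2"
    by (simp add: power2_norm_eq_inner inner_diff_left inner_diff_right inner_commute)
  moreover have "2 * ((Y - Z) \<bullet> (Z - B)) = J \<bullet> (transpose V ** V)"
  proof -
    have VV: "transpose V ** V = 2 *\<^sub>R mat 1 - transpose Z ** B - transpose B ** Z"
      using Z B by (simp add: V_def mat_distrib stiefel_def scaleR_2 algebra_simps)
    have "J \<bullet> (transpose B ** Z) = J \<bullet> (transpose Z ** B)"
      by (metis inner_transpose matrix_transpose_mul tJ transpose_transpose)
    moreover have "(Y - Z) \<bullet> (Z - B) = J \<bullet> (mat 1 - transpose Z ** B)"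
      using Z by (simp add: YZ inner_matrix_mult_left mat_distrib stiefel_def)
    ultimately show ?thesis by (simp add: VV inner_diff_right)
  qed
  ultimately show "(norm (Y - Z))\<^sup>2 + (norm (Z - B))\<^sup>2 \<le> (norm (Y - B))\<^sup>2"
    using psd_inner_nonneg[of J V] J by (simp add: J_def)
qed (fact Z)

section \<open>Projection onto the block manifold\<close>

lemma transpose_sel [simp]: "transpose (sel C) = sel C"
  by (simp add: vec_eq_iff sel_def transpose_def)

lemma sel_mult_left: "(sel C ** A) $ i $ j = (if i \<in> C then A $ i $ j else 0)" for A :: "real ^ 'm ^ 'p"
proof -
  have "(\<Sum>k\<in>UNIV. (if i = k \<and> k \<in> C then 1 else 0) * A $ k $ j) = (\<Sum>k\<in>UNIV. if k = i then (if i \<in> C then A $ i $ j else 0) else 0)"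
    by (intro sum.cong) auto
  then show ?thesis by (simp add: matrix_matrix_mult_def sel_def)
qed

lemma sel_mult_right: "(A ** sel C) $ i $ j = (if j \<in> C then A $ i $ j else 0)" for A :: "real ^ 'p ^ 'n"
proof -
  have "(A ** sel C) $ i $ j = (sel C ** transpose A) $ j $ i"
    by (metis (no_types, lifting) matrix_transpose_mul transpose_sel transpose_transpose transpose_def vec_lambda_beta)
  then show ?thesis by (simp add: sel_mult_left transpose_def)
qed

lemma sel_mult_sel [simp]: "sel C ** sel D = sel (C \<inter> D)"
  by (simp add: vec_eq_iff sel_mult_left) (simp add: sel_def)

lemma sel_empty [simp]: "sel {} = 0"
  by (simp add: vec_eq_iff sel_def)

lemma sel_Compl_add: "sel C + sel (- C) = mat 1"
  by (simp add: vec_eq_iff sel_def mat_def)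

lemma mult_sel_sel [simp]: "A ** sel C ** sel D = A ** sel (C \<inter> D)" for A :: "real ^ 'p ^ 'n"
  by (simp flip: matrix_mul_assoc)

lemma cols_split: "cols A C + cols A (- C) = A"
  by (simp add: cols_def sel_Compl_add flip: matrix_add_ldistrib)

lemma norm_mult_sel_le: "norm (A ** sel C) \<le> norm A" for A :: "real ^ 'p ^ 'n"
  by (rule power2_le_imp_le) (auto simp: norm_matrix_power2 sel_mult_right intro!: sum_mono)

section \<open>Rank-one matrices and Householder reflections\<close>

definition outer :: "real ^ 'n \<Rightarrow> real ^ 'm \<Rightarrow> real ^ 'm ^ 'n"
  where "outer v w = (\<chi> i j. v $ i * w $ j)"

lemma inner_outer: "M \<bullet> outer v w = v \<bullet> (M *v w)" for M :: "real ^ 'm ^ 'n"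
  by (simp add: inner_vec_def outer_def matrix_vector_mult_def sum_distrib_left mult_ac)

lemma outer_mult_outer: "outer v w ** outer a b = (w \<bullet> a) *\<^sub>R outer v b"
  by (simp add: vec_eq_iff outer_def matrix_matrix_mult_def inner_vec_def sum_distrib_left mult_ac)

lemma transpose_outer [simp]: "transpose (outer v w) = outer w v"
  by (simp add: vec_eq_iff outer_def transpose_def mult.commute)

lemma outer_mult: "outer v w ** A = outer v (transpose A *v w)" for A :: "real ^ 'k ^ 'm"
  by (simp add: vec_eq_iff outer_def matrix_matrix_mult_def vector_matrix_mult_def sum_distrib_left mult_ac)

lemma outer_zero [simp]: "outer v 0 = 0"
  by (simp add: vec_eq_iff outer_def)

text \<open>The Householder reflection in the hyperplane orthogonal to \<open>v\<close>. For
  \<open>v = 0\<close> it is the identity, since division by zero gives zero.\<close>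

definition refl_mat :: "real ^ 'n \<Rightarrow> real ^ 'n ^ 'n"
  where "refl_mat v = mat 1 - (2 / (v \<bullet> v)) *\<^sub>R outer v v"

lemma refl_mat_involution: "refl_mat v ** refl_mat v = mat 1"
  by (cases "v = 0")
     (simp_all add: refl_mat_def mat_distrib outer_mult_outer algebra_simps flip: scaleR_add_left)

lemma transpose_refl_mat [simp]: "transpose (refl_mat v) = refl_mat v"
  by (simp add: refl_mat_def mat_distrib)

lemma refl_mat_fixes: "transpose N *v v = 0 \<Longrightarrow> refl_mat v ** N = N" for N :: "real ^ 'p ^ 'n"
  by (simp add: refl_mat_def mat_distrib outer_mult del: transpose_matrix_vector)

text \<open>A first-order optimality condition without derivatives. One reflection shows that the
  form is nonnegative. For \<open>v + t z\<close> nonzero, the product of the reflections in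
  \<open>v\<close> and \<open>v + t z\<close> is a rotation by an angle of order \<open>t\<close>,
  and small \<open>t\<close> of suitable sign rules out a skew part. Vectors orthogonal to the
  columns of \<open>N\<close> give reflections that fix \<open>N\<close>, so these competitors are
  admissible.\<close>

lemma symmetric_of_maximal:
  fixes M :: "real ^ 'n ^ 'n" and N :: "real ^ 'p ^ 'n"
  assumes max: "\<And>Q. transpose Q ** Q = mat 1 \<Longrightarrow> Q ** N = N \<Longrightarrow> M \<bullet> Q \<le> M \<bullet> mat 1"
    and v: "transpose N *v v = 0" and z: "transpose N *v z = 0"
  shows "0 \<le> v \<bullet> (M *v v)" and "v \<bullet> (M *v z) = z \<bullet> (M *v v)"
proof -
  have nonneg: "0 \<le> v \<bullet> (M *v v)" if "transpose N *v v = 0" for v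
  proof (cases "v = 0")
    case False
    have "M \<bullet> refl_mat v \<le> M \<bullet> mat 1"
      using that by (intro max) (simp_all add: refl_mat_involution refl_mat_fixes del: transpose_matrix_vector)
    then have "0 \<le> (2 / (v \<bullet> v)) * (v \<bullet> (M *v v))"
      by (simp add: refl_mat_def inner_diff_right inner_outer)
    moreover have "0 < 2 / (v \<bullet> v)" using False by simp
    ultimately show ?thesis by (meson zero_le_mult_iff not_less)
  qed simp
  then show "0 \<le> v \<bullet> (M *v v)" using v .
  have two: "2 * (v \<bullet> w) * (v \<bullet> (M *v w)) \<le> (v \<bullet> (M *v v)) * (w \<bullet> w) + (w \<bullet> (M *v w)) * (v \<bullet> v)"
    if v: "transpose N *v v = 0" and w: "transpose N *v w = 0" and "v \<noteq> 0" "w \<noteq> 0" for v w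
  proof -
    have "M \<bullet> (refl_mat v ** refl_mat w) \<le> M \<bullet> mat 1"
    proof (rule max)
      have "transpose (refl_mat v ** refl_mat w) ** (refl_mat v ** refl_mat w)
          = refl_mat w ** (refl_mat v ** refl_mat v) ** refl_mat w"
        by (simp add: matrix_transpose_mul matrix_mul_assoc)
      then show "transpose (refl_mat v ** refl_mat w) ** (refl_mat v ** refl_mat w) = mat 1"
        by (simp add: refl_mat_involution)
      show "refl_mat v ** refl_mat w ** N = N"
        using v w by (simp add: refl_mat_fixes flip: matrix_mul_assoc del: transpose_matrix_vector)
    qed
    moreover have "refl_mat v ** refl_mat w = mat 1 - (2 / (v \<bullet> v)) *\<^sub>R outer v v - (2 / (w \<bullet> w)) *\<^sub>R outer w w
        + (2 / (v \<bullet> v) * (2 / (w \<bullet> w)) * (v \<bullet> w)) *\<^sub>R outer v w"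
      by (simp add: refl_mat_def mat_distrib outer_mult_outer algebra_simps)
    ultimately have "2 / (v \<bullet> v) * (2 / (w \<bullet> w)) * (v \<bullet> w) * (v \<bullet> (M *v w))
        \<le> 2 / (v \<bullet> v) * (v \<bullet> (M *v v)) + 2 / (w \<bullet> w) * (w \<bullet> (M *v w))"
      by (simp add: inner_diff_right inner_add_right inner_outer)
    moreover have "0 < v \<bullet> v" "0 < w \<bullet> w" using that by auto
    ultimately show ?thesis by (simp add: field_simps)
  qed
  show "v \<bullet> (M *v z) = z \<bullet> (M *v v)"
  proof (cases "v = 0")
    case False
    define a b c d where "a = v \<bullet> (M *v v)" and "b = v \<bullet> (M *v z)" and "c = z \<bullet> (M *v v)" and "d = z \<bullet> (M *v z)"
    define r s q where "r = v \<bullet> v" and "s = v \<bullet> z" and "q = z \<bullet> z"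
    have r: "r > 0" using False by (simp add: r_def)
    \<comment> \<open>With \<open>w = v + t z\<close> in \<open>two\<close>, the terms of order zero
      in \<open>t\<close> cancel. What remains is a linear term, for either sign of
      \<open>t\<close>, below a quadratic one.\<close>
    have key: "t * r * (b - c) \<le> t\<^sup>2 * (a * q + r * d - 2 * s * b)" for t
    proof (cases "v + t *\<^sub>R z = 0")
      case True
      then have vz: "v = (- t) *\<^sub>R z" by (simp add: eq_neg_iff_add_eq_0)
      show ?thesis unfolding a_def b_def c_def d_def r_def s_def q_def
        unfolding vz by (simp add: matrix_vector_mult_scaleR power2_eq_square algebra_simps)
    next
      case nz: False
      have i: "2 * (v \<bullet> (v + t *\<^sub>R z)) * (v \<bullet> (M *v (v + t *\<^sub>R z)))
          \<le> (v \<bullet> (M *v v)) * ((v + t *\<^sub>R z) \<bullet> (v + t *\<^sub>R z)) + ((v + t *\<^sub>R z) \<bullet> (M *v (v + t *\<^sub>R z))) * (v \<bullet> v)"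
        using v z False nz
        by (intro two) (simp_all add: matrix_vector_right_distrib matrix_vector_mult_scaleR del: transpose_matrix_vector)
      have e1: "v \<bullet> (v + t *\<^sub>R z) = r + t * s" by (simp add: r_def s_def inner_add_right)
      have e2: "v \<bullet> (M *v (v + t *\<^sub>R z)) = a + t * b"
        by (simp add: a_def b_def inner_add_right matrix_vector_right_distrib matrix_vector_mult_scaleR)
      have e3: "(v + t *\<^sub>R z) \<bullet> (v + t *\<^sub>R z) = r + 2 * t * s + t\<^sup>2 * q"
        by (simp add: r_def s_def q_def inner_add_right inner_add_left inner_commute power2_eq_square algebra_simps)
      have e4: "(v + t *\<^sub>R z) \<bullet> (M *v (v + t *\<^sub>R z)) = a + t * b + t * c + t\<^sup>2 * d"
        by (simp add: a_def b_def c_def d_def inner_add_right inner_add_left matrix_vector_right_distrib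
            matrix_vector_mult_scaleR power2_eq_square algebra_simps)
      have "2 * (r + t * s) * (a + t * b) \<le> a * (r + 2 * t * s + t\<^sup>2 * q) + (a + t * b + t * c + t\<^sup>2 * d) * r"
        using i unfolding e1 e2 e3 e4 a_def[symmetric] r_def[symmetric] .
      then show ?thesis by (simp add: power2_eq_square algebra_simps)
    qed
    define h where "h = a * q + r * d - 2 * s * b"
    have "b - c = 0"
    proof (rule ccontr)
      assume ne: "b - c \<noteq> 0"
      \<comment> \<open>Chosen so that the linear side equals \<open>2 (|h| + 1) t^2\<close>, which
        exceeds \<open>h t^2\<close>.\<close>
      define t where "t = r * (b - c) / (2 * (\<bar>h\<bar> + 1))"
      have "r * (b - c) = 2 * (\<bar>h\<bar> + 1) * t"
        using abs_ge_zero[of h] by (simp add: t_def del: abs_ge_zero)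
      then have "t * r * (b - c) = 2 * (\<bar>h\<bar> + 1) * t\<^sup>2"
        by (simp add: power2_eq_square)
      moreover have "t\<^sup>2 > 0" using ne r by (simp add: t_def)
      ultimately have "2 * (\<bar>h\<bar> + 1) \<le> h" using key[of t] unfolding h_def[symmetric]
        by (metis mult.commute mult_le_cancel_left_pos)
      then show False using abs_ge_self[of h] abs_ge_zero[of h] by argo
    qed
    then show ?thesis by (simp add: b_def c_def)
  qed simp
qed

section \<open>The block manifold and its nearest points\<close>

lemma block_manifold_mult:
  assumes Z: "Z \<in> block_manifold X C" and Q: "transpose Q ** Q = mat 1" "Q ** cols X (- C) = cols X (- C)"
  shows "Q ** Z \<in> block_manifold X C"
proof -
  have "transpose (cols X (- C)) ** (Q ** Z) = transpose (Q ** cols X (- C)) ** (Q ** Z)"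
    by (simp add: Q(2))
  also have "\<dots> = transpose (cols X (- C)) ** (transpose Q ** Q) ** Z"
    by (simp add: matrix_transpose_mul matrix_mul_assoc)
  finally have 1: "transpose (cols X (- C)) ** (Q ** Z) = 0"
    using Z by (simp add: Q block_manifold_def)
  have "transpose (Q ** Z) ** (Q ** Z) = transpose Z ** (transpose Q ** Q) ** Z"
    by (simp add: matrix_transpose_mul matrix_mul_assoc)
  then show ?thesis using Z 1
    by (simp add: block_manifold_def stiefel_on_def cols_def Q flip: matrix_mul_assoc)
qed

lemma cols_in_block_manifold:
  assumes "X \<in> stiefel" shows "cols X C \<in> block_manifold X C"
proof -
  have "transpose (cols X D) ** cols X C = sel D ** (transpose X ** X) ** sel C" for D
    by (simp add: cols_def matrix_transpose_mul matrix_mul_assoc)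
  then show ?thesis using assms
    by (simp add: block_manifold_def stiefel_on_def stiefel_def) (simp add: cols_def)
qed

lemma stiefel_of_block:
  assumes X: "X \<in> stiefel" and Z: "Z \<in> block_manifold X C"
  shows "Z + cols X (- C) \<in> stiefel"
proof -
  have 1: "transpose (cols X (- C)) ** Z = 0" "transpose Z ** Z = sel C"
    using Z by (auto simp: block_manifold_def stiefel_on_def)
  have 2: "transpose Z ** cols X (- C) = 0"
    using arg_cong[OF 1(1), of transpose] by (simp add: matrix_transpose_mul linear_0[OF linear_transpose])
  have "transpose (cols X (- C)) ** cols X (- C) = sel (- C)"
    using cols_in_block_manifold[OF X, of "- C"] by (simp add: block_manifold_def stiefel_on_def)
  then show ?thesis using 1 2 by (simp add: stiefel_def mat_distrib sel_Compl_add)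
qed

lemma closed_block_manifold: "closed (block_manifold X C)"
proof -
  have "block_manifold X C = {Y. Y ** sel C = Y} \<inter> {Y. transpose Y ** Y = sel C}
      \<inter> {Y. transpose (cols X (- C)) ** Y = 0}"
    by (auto simp: block_manifold_def stiefel_on_def cols_def)
  also have "closed \<dots>"
    by (intro closed_Int closed_Collect_eq matmul.continuous_on continuous_intros)
  finally show ?thesis .
qed

text \<open>The nearest point \<open>Z\<close> of \<open>Y\<close> on the block manifold maximises \<open>Q \<mapsto> Y \<bullet> (Q ** Z)\<close> over the
  orthogonal matrices fixing the remaining columns; testing with products of two reflections
  shows that \<open>Y Z\<^sup>T\<close> is symmetric positive semidefinite, i.e. \<open>Z\<close> is the polar factor of \<open>Y\<close>.\<close>

lemma closest_block_polar:
  fixes X :: "real ^ 'p ^ 'n"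
  assumes X: "X \<in> stiefel" and Y: "cols Y C = Y" "transpose (cols X (- C)) ** Y = 0"
    and Z: "Z = closest_point (block_manifold X C) Y"
  shows "Z \<in> block_manifold X C" and "psd (transpose Y ** Z)" and "Y = Z ** (transpose Y ** Z)"
proof -
  let ?N = "cols X (- C)"
  have ne: "block_manifold X C \<noteq> {}" using cols_in_block_manifold[OF X] by blast
  show Zm: "Z \<in> block_manifold X C"
    unfolding Z by (rule closest_point_in_set[OF closed_block_manifold ne])
  then have Zc: "Z ** sel C = Z" and ZZ: "transpose Z ** Z = sel C" and NZ: "transpose ?N ** Z = 0"
    by (auto simp: block_manifold_def stiefel_on_def cols_def)
  have Yc: "Y ** sel C = Y" using Y by (simp add: cols_def)
  have sY: "sel C ** transpose Y = transpose Y"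
    by (metis Yc matrix_transpose_mul transpose_sel)
  define M where "M = Y ** transpose Z"
  \<comment> \<open>\<open>Q Z\<close> has the same norm as \<open>Z\<close>, so comparing distances
    to \<open>Y\<close> amounts to comparing inner products with \<open>Y\<close>.\<close>
  have max: "M \<bullet> Q \<le> M \<bullet> mat 1" if Q: "transpose Q ** Q = mat 1" "Q ** ?N = ?N" for Q
  proof -
    have QZ: "Q ** Z \<in> block_manifold X C" using block_manifold_mult[OF Zm Q] .
    have "dist Y Z \<le> dist Y (Q ** Z)"
      unfolding Z by (intro closest_point_le closed_block_manifold QZ[unfolded Z])
    moreover have "norm (Q ** Z) = norm Z"
      by (simp add: norm_eq_sqrt_inner inner_matrix_mult_left matrix_mul_assoc Q)
    ultimately have "Y \<bullet> (Q ** Z) \<le> Y \<bullet> Z"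
      by (simp add: dist_norm norm_le inner_diff_left inner_diff_right inner_commute norm_eq)
    moreover have "Y \<bullet> (Q ** Z) = M \<bullet> Q" "Y \<bullet> Z = M \<bullet> mat 1"
      unfolding M_def by (simp_all add: inner_matrix_mult_right)
    ultimately show ?thesis by simp
  qed
  \<comment> \<open>The reflections test \<open>M\<close> only on vectors orthogonal to the
    remaining columns. \<open>P\<close> projects onto these vectors and \<open>M = P M P\<close>, so
    the conclusions extend to all vectors.\<close>
  define P where "P = mat 1 - ?N ** transpose ?N"
  have NN: "transpose ?N ** ?N = sel (- C)"
    using cols_in_block_manifold[OF X, of "- C"] by (simp add: block_manifold_def stiefel_on_def)
  have tP: "transpose P = P" by (simp add: P_def mat_distrib matrix_transpose_mul)
  have NP: "transpose ?N ** P = 0"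
  proof -
    have "sel (- C) ** transpose ?N = transpose ?N"
      by (simp add: cols_def matrix_transpose_mul matrix_mul_assoc)
    then show ?thesis by (simp add: P_def mat_distrib matrix_mul_assoc NN)
  qed
  have PY: "P ** Y = Y" using Y by (simp add: P_def mat_distrib flip: matrix_mul_assoc)
  have PZ: "P ** Z = Z" using NZ by (simp add: P_def mat_distrib flip: matrix_mul_assoc)
  have ZP: "transpose Z ** P = transpose Z"
    by (metis PZ matrix_transpose_mul tP)
  have MP: "P ** M ** P = M" by (simp add: M_def matrix_mul_assoc PY) (simp add: ZP flip: matrix_mul_assoc)
  have NPv: "transpose ?N *v (P *v v) = 0" for v
    by (simp add: matrix_vector_mul_assoc NP del: transpose_matrix_vector)
  have form: "v \<bullet> (M *v w) = (P *v v) \<bullet> (M *v (P *v w))" for v w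
  proof -
    have "(P *v v) \<bullet> (M *v (P *v w)) = v \<bullet> ((P ** M ** P) *v w)"
      by (simp add: inner_matrix_vector tP matrix_vector_mul_assoc matrix_mul_assoc del: transpose_matrix_vector)
    then show ?thesis by (simp add: MP)
  qed
  have Mnn: "0 \<le> v \<bullet> (M *v v)" for v
    unfolding form[of v v] by (rule symmetric_of_maximal(1)[OF max NPv NPv])
  have Msym: "v \<bullet> (M *v w) = w \<bullet> (M *v v)" for v w
    unfolding form[of v w] form[of w v] by (rule symmetric_of_maximal(2)[OF max NPv NPv])
  have tM: "transpose M = M"
  proof -
    have "M $ i $ j = M $ j $ i" for i j
      using Msym[of "axis i 1" "axis j 1"]
      by (simp add: matrix_vector_mul_component inner_axis inner_axis')
    then show ?thesis by (simp add: vec_eq_iff transpose_def)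
  qed
  have "Y = M ** Z" by (simp add: M_def ZZ Yc flip: matrix_mul_assoc)
  also have "\<dots> = Z ** (transpose Y ** Z)"
    by (subst tM[symmetric]) (simp add: M_def matrix_transpose_mul matrix_mul_assoc)
  finally show YZK: "Y = Z ** (transpose Y ** Z)" .
  have "transpose Z ** Y = transpose Z ** Z ** (transpose Y ** Z)"
    by (subst YZK) (simp add: matrix_mul_assoc)
  also have "\<dots> = transpose Y ** Z" by (simp add: ZZ matrix_mul_assoc sY)
  finally have ZY: "transpose Z ** Y = transpose Y ** Z" .
  have "x \<bullet> ((transpose Y ** Z) *v x) = (Z *v x) \<bullet> (M *v (Z *v x))" for x
  proof -
    have "(Z *v x) \<bullet> (M *v (Z *v x)) = x \<bullet> ((transpose Z ** M ** Z) *v x)"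
      by (simp add: inner_matrix_vector matrix_vector_mul_assoc matrix_mul_assoc del: transpose_matrix_vector)
    also have "transpose Z ** M ** Z = transpose Z ** Y"
      by (metis \<open>Y = M ** Z\<close> matrix_mul_assoc)
    finally show ?thesis by (simp add: ZY)
  qed
  then show "psd (transpose Y ** Z)"
    unfolding psd_def using Mnn ZY by (simp add: matrix_transpose_mul)
qed

section \<open>The tangent step\<close>

definition sym_part :: "real ^ 'p ^ 'p \<Rightarrow> real ^ 'p ^ 'p"
  where "sym_part A = (1 / 2) *\<^sub>R (A + transpose A)"

text \<open>For \<open>X\<close> on the Stiefel manifold, the orthogonal projection of
  \<open>D\<close> onto the tangent space of the whole manifold at \<open>X\<close>: the Riemannian
  subgradient.\<close>

definition tangent_grad :: "real ^ 'p ^ 'n \<Rightarrow> real ^ 'p ^ 'n \<Rightarrow> real ^ 'p ^ 'n"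
  where "tangent_grad X D = D - X ** sym_part (transpose X ** D)"

text \<open>One summand of \<open>avg_op\<close>, kept in literally the same form so that it can be
  folded there. \<open>block_proj_eq\<close> is the form used in calculations.\<close>

definition block_proj :: "real ^ 'p ^ 'n \<Rightarrow> 'p set \<Rightarrow> real ^ 'p ^ 'n \<Rightarrow> real ^ 'p ^ 'n"
  where "block_proj X C \<xi> = (mat 1 - cols X (- C) ** transpose (cols X (- C))) ** cols \<xi> C ** transpose (sel C)"

lemma transpose_sym_part [simp]: "transpose (sym_part A) = sym_part A"
  by (simp add: sym_part_def mat_distrib add.commute)

lemma inner_skew_sym: "transpose A = - A \<Longrightarrow> transpose S = S \<Longrightarrow> A \<bullet> S = 0" for A S :: "real ^ 'n ^ 'n"
  using inner_transpose[of A S] by simp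

lemma inner_sym_part: "transpose S = S \<Longrightarrow> sym_part A \<bullet> S = A \<bullet> S" for A S :: "real ^ 'n ^ 'n"
  using inner_transpose[of A S] by (simp add: sym_part_def inner_add_left)

lemma tangent_grad_skew:
  assumes "X \<in> stiefel"
  shows "transpose (transpose X ** tangent_grad X D) = - (transpose X ** tangent_grad X D)"
proof -
  have "transpose X ** tangent_grad X D = transpose X ** D - sym_part (transpose X ** D)"
    using assms by (simp add: tangent_grad_def mat_distrib matrix_mul_assoc stiefel_def)
  also have "\<dots> = (1 / 2) *\<^sub>R (transpose X ** D - transpose (transpose X ** D))"
    by (simp add: sym_part_def vec_eq_iff field_simps)
  finally have e: "transpose X ** tangent_grad X D = (1 / 2) *\<^sub>R (transpose X ** D - transpose (transpose X ** D))" .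
  have "transpose ((1 / 2) *\<^sub>R (B - transpose B)) = - ((1 / 2) *\<^sub>R (B - transpose B))" for B :: "real ^ 'a ^ 'a"
    by (simp add: vec_eq_iff transpose_def field_simps)
  then show ?thesis unfolding e .
qed

lemma inner_tangent_grad_normal:
  assumes "X \<in> stiefel" and "transpose S = S"
  shows "tangent_grad X D \<bullet> (X ** S) = 0"
proof -
  have "tangent_grad X D \<bullet> (X ** S) = (transpose X ** tangent_grad X D) \<bullet> S"
    by (simp add: inner_matrix_mult_left)
  then show ?thesis using inner_skew_sym[OF tangent_grad_skew[OF assms(1)] assms(2)] by simp
qed

text \<open>The orthogonal splitting of \<open>D\<close> into a tangent and a normal part; it bounds
  both parts by \<open>norm D\<close>.\<close>

lemma tangent_grad_pythagoras:
  assumes "X \<in> stiefel"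
  shows "(norm D)\<^sup>2 = (norm (tangent_grad X D))\<^sup>2 + (norm (sym_part (transpose X ** D)))\<^sup>2"
proof -
  define S where "S = sym_part (transpose X ** D)"
  have D: "D = tangent_grad X D + X ** S" by (simp add: tangent_grad_def S_def)
  have "tangent_grad X D \<bullet> (X ** S) = 0"
    using assms by (intro inner_tangent_grad_normal) (simp_all add: S_def)
  then have "norm (tangent_grad X D + X ** S) ^ 2 = (norm (tangent_grad X D))\<^sup>2 + (norm (X ** S))\<^sup>2"
    by (intro norm_add_Pythagorean) (simp add: orthogonal_def)
  then show ?thesis by (metis D S_def norm_isometry_mult[OF assms])
qed

lemma block_proj_eq: "block_proj X C \<xi> = \<xi> ** sel C - X ** (sel (- C) ** (transpose X ** \<xi>) ** sel C)"
proof -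
  have "cols X (- C) ** transpose (cols X (- C)) = X ** sel (- C) ** transpose X"
    by (simp add: cols_def matrix_transpose_mul matrix_mul_assoc)
  then show ?thesis by (simp add: block_proj_def cols_def mat_distrib matrix_mul_assoc)
qed

lemma block_proj_cols: "block_proj X C \<xi> ** sel C = block_proj X C \<xi>"
  by (simp add: block_proj_eq mat_distrib matrix_mul_assoc)

lemma transpose_mult_block_proj:
  assumes "X \<in> stiefel"
  shows "transpose X ** block_proj X C \<xi> = sel C ** (transpose X ** \<xi>) ** sel C"
proof -
  have "transpose X ** block_proj X C \<xi>
      = transpose X ** \<xi> ** sel C - sel (- C) ** (transpose X ** \<xi>) ** sel C"
    using assms by (simp add: block_proj_eq mat_distrib matrix_mul_assoc stiefel_def)
  also have "\<dots> = sel C ** (transpose X ** \<xi>) ** sel C"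
    by (simp add: vec_eq_iff sel_mult_left sel_mult_right)
  finally show ?thesis .
qed

text \<open>For Stiefel \<open>X\<close>, \<open>block_proj X C\<close> is the orthogonal projection
  onto the space described by the two assumptions on \<open>t\<close>. This is the orthogonality of
  its residual to that space.\<close>

lemma inner_block_proj:
  assumes "t ** sel C = t" "transpose (cols X (- C)) ** t = 0"
  shows "block_proj X C \<xi> \<bullet> t = \<xi> \<bullet> t"
proof -
  have "transpose (cols X (- C)) ** t = sel (- C) ** (transpose X ** t)"
    by (simp add: cols_def matrix_transpose_mul matrix_mul_assoc)
  then have 0: "sel (- C) ** (transpose X ** t) = 0" using assms(2) by simp
  have "(X ** (sel (- C) ** (transpose X ** \<xi>) ** sel C)) \<bullet> t
      = (transpose X ** \<xi> ** sel C) \<bullet> (sel (- C) ** (transpose X ** t))"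
    by (simp only: inner_matrix_mult_left transpose_sel flip: matrix_mul_assoc)
  then have "(X ** (sel (- C) ** (transpose X ** \<xi>) ** sel C)) \<bullet> t = 0" by (simp add: 0)
  moreover have "(\<xi> ** sel C) \<bullet> t = \<xi> \<bullet> t"
    by (simp add: inner_matrix_mult_right assms(1))
  ultimately show ?thesis by (simp add: block_proj_eq inner_diff_left)
qed

lemma norm_block_proj_le:
  assumes X: "X \<in> stiefel"
  shows "norm (block_proj X C \<xi>) \<le> norm (\<xi> ** sel C)"
proof -
  let ?P = "block_proj X C \<xi>"
  have "transpose (cols X (- C)) ** ?P = sel (- C) ** (transpose X ** ?P)"
    by (simp add: cols_def matrix_transpose_mul matrix_mul_assoc)
  also have "\<dots> = 0" by (simp add: transpose_mult_block_proj[OF X] matrix_mul_assoc)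
  finally have "?P \<bullet> ?P = \<xi> \<bullet> ?P"
    by (intro inner_block_proj block_proj_cols)
  also have "\<dots> = (\<xi> ** sel C) \<bullet> ?P"
    by (simp add: inner_matrix_mult_right block_proj_cols)
  also have "\<dots> \<le> norm (\<xi> ** sel C) * norm ?P" by (rule norm_cauchy_schwarz)
  finally show ?thesis by (cases "?P = 0") (auto simp: power2_norm_eq_inner[symmetric] power2_eq_square)
qed

lemma subspace_block_tangent: "subspace (block_tangent X C)"
proof -
  have "block_tangent X C = {\<xi>. \<xi> ** sel C - \<xi> = 0}
      \<inter> {\<xi>. transpose \<xi> ** cols X C + transpose (cols X C) ** \<xi> = 0}
      \<inter> {\<xi>. transpose (cols X (- C)) ** \<xi> = 0}"
    by (auto simp: block_tangent_def cols_def)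
  also have "subspace \<dots>"
    by (intro subspace_inter linear_subspace_kernel linearI)
       (simp_all add: mat_distrib scaleR_add_right scaleR_diff_right)
  finally show ?thesis .
qed

text \<open>The block tangent space lies inside the full tangent space, so one may project onto the
  latter first: the discarded normal part \<open>X S\<close> with \<open>S\<close> symmetric is
  orthogonal to every \<open>t\<close> with \<open>X^T t\<close> skew. As a result the directions of
  all pairs are images of one matrix \<open>tangent_grad X D\<close>, which is what makes them
  summable over the pairs.\<close>

lemma closest_block_tangent:
  fixes X D :: "real ^ 'p ^ 'n" and C :: "'p set"
  assumes X: "X \<in> stiefel"
  defines "G \<equiv> \<lambda>D. block_proj X C (tangent_grad X D)"
  shows "closest_point (block_tangent X C) (D ** sel C) = G D" and "G D \<in> block_tangent X C"
    and "transpose X ** G D = sel C ** (transpose X ** tangent_grad X D) ** sel C"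
    and "transpose (G D) ** X = - (transpose X ** G D)"
proof -
  let ?T = "block_tangent X C" and ?A = "transpose X ** tangent_grad X D"
  have XG: "transpose X ** G D = sel C ** ?A ** sel C"
    unfolding G_def by (rule transpose_mult_block_proj[OF X])
  then show "transpose X ** G D = sel C ** ?A ** sel C" .
  have GX: "transpose (G D) ** X = - (transpose X ** G D)"
  proof -
    have "transpose (G D) ** X = transpose (sel C ** ?A ** sel C)"
      by (metis XG matrix_transpose_mul transpose_transpose)
    also have "\<dots> = sel C ** (transpose ?A ** sel C)"
      by (simp only: matrix_transpose_mul transpose_sel)
    also have "\<dots> = - (transpose X ** G D)"
      by (simp only: XG tangent_grad_skew[OF X] matmul.minus_left matmul.minus_right matrix_mul_assoc)
    finally show ?thesis .
  qed
  then show "transpose (G D) ** X = - (transpose X ** G D)" .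
  have Gc: "cols (G D) C = G D" by (simp add: cols_def G_def block_proj_cols)
  have 2: "transpose (cols X E) ** G D = sel E ** (transpose X ** G D)" for E
    by (simp add: cols_def matrix_transpose_mul matrix_mul_assoc)
  have "transpose (G D) ** cols X C = (transpose (G D) ** X) ** sel C"
    by (simp add: cols_def matrix_mul_assoc)
  also have "\<dots> = - (sel C ** ?A ** sel C)"
    by (simp only: GX XG matmul.minus_left mult_sel_sel Int_absorb)
  also have "\<dots> = - (transpose (cols X C) ** G D)"
    by (simp add: 2 XG matrix_mul_assoc)
  finally have "transpose (G D) ** cols X C = - (transpose (cols X C) ** G D)" .
  then show GT: "G D \<in> ?T"
    using Gc by (simp add: block_tangent_def 2) (simp add: XG matrix_mul_assoc)
  show "closest_point ?T (D ** sel C) = G D"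
  proof (rule closest_point_unique[symmetric])
    show "convex ?T" by (rule subspace_imp_convex[OF subspace_block_tangent])
    show "closed ?T" by (rule closed_subspace[OF subspace_block_tangent])
    show "\<forall>z\<in>?T. dist (D ** sel C) (G D) \<le> dist (D ** sel C) z"
    proof
      fix z assume z: "z \<in> ?T"
      define t where "t = G D - z"
      have tT: "t \<in> ?T" unfolding t_def by (rule subspace_diff[OF subspace_block_tangent GT z])
      then have t: "t ** sel C = t" "transpose (cols X (- C)) ** t = 0"
         and sk: "transpose t ** cols X C + transpose (cols X C) ** t = 0"
        by (auto simp: block_tangent_def cols_def)
      have Xt: "transpose X ** t = transpose (cols X C) ** t"
        using t(2) cols_split[of X C] by (metis add.right_neutral matmul.add_left linear_add[OF linear_transpose])
      have "(D ** sel C - G D) \<bullet> t = D \<bullet> t - tangent_grad X D \<bullet> t"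
        using t by (simp add: inner_diff_left G_def inner_block_proj inner_matrix_mult_right)
      also have "\<dots> = (X ** sym_part (transpose X ** D)) \<bullet> t"
        by (simp add: tangent_grad_def inner_diff_left)
      also have "\<dots> = (transpose X ** t) \<bullet> sym_part (transpose X ** D)"
        by (subst inner_matrix_mult_left) (rule inner_commute)
      also have "\<dots> = 0"
      proof (rule inner_skew_sym)
        show "transpose (transpose X ** t) = - (transpose X ** t)"
          unfolding Xt using sk by (simp add: matrix_transpose_mul eq_neg_iff_add_eq_0)
      qed simp
      finally have o: "(D ** sel C - G D) \<bullet> t = 0" .
      have p: "norm (D ** sel C - G D + t) ^ 2 = (norm (D ** sel C - G D))\<^sup>2 + (norm t)\<^sup>2"
        using o by (intro norm_add_Pythagorean) (simp add: orthogonal_def)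
      have e: "D ** sel C - G D + t = D ** sel C - z" by (simp only: t_def add_diff_eq diff_add_cancel)
      have "(norm (D ** sel C - G D))\<^sup>2 \<le> (norm (D ** sel C - z))\<^sup>2"
        unfolding e[symmetric] p by simp
      then show "dist (D ** sel C) (G D) \<le> dist (D ** sel C) z"
        unfolding dist_norm by (rule power2_le_imp_le) simp
    qed
  qed (fact GT)
qed

lemma psd_add_sel: "psd K \<Longrightarrow> psd (K + sel C)"
proof -
  have "0 \<le> x \<bullet> (sel C *v x)" for x :: "real ^ 'a"
  proof -
    have "x \<bullet> (sel C *v x) = (sel C *v x) \<bullet> (sel C *v x)"
      by (simp add: inner_matrix_vector matrix_vector_mul_assoc del: transpose_matrix_vector)
    then show ?thesis by simp
  qed
  then show "psd K \<Longrightarrow> psd (K + sel C)"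
    by (simp add: psd_def mat_distrib matrix_vector_mult_add_rdistrib inner_add_right)
qed

text \<open>Passes from the block to the full matrix: \<open>X'\<close> is the polar factor of the
  whole trial point. Thus steps with different pairs, and the comparison point, live in one space
  and share one projection inequality.\<close>

lemma rssm_step_strong_proj:
  assumes X: "X \<in> stiefel" and step: "rssm_step \<gamma> e D X X'"
  defines "G \<equiv> block_proj X (\<Union>e) (tangent_grad X D)"
  shows "strong_proj (X - \<gamma> *\<^sub>R G) X'"
    and "2 * norm (X' - (X - \<gamma> *\<^sub>R G)) \<le> \<gamma>\<^sup>2 * (norm G)\<^sup>2"
proof -
  let ?C = "\<Union>e"
  define Z where "Z = cols X' ?C"
  define N where "N = cols X (- ?C)"
  define Y where "Y = cols X ?C - \<gamma> *\<^sub>R G"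
  note G = closest_block_tangent[OF X, of ?C D, folded G_def]
  have Z: "Z = closest_point (block_manifold X ?C) Y" and N': "cols X' (- ?C) = N"
    using step G(1) by (simp_all add: rssm_step_def Z_def Y_def N_def Let_def)
  have X': "X' = Z + N" using cols_split[of X' ?C] by (simp add: Z_def N')
  have GT: "cols G ?C = G" "transpose N ** G = 0" using G(2) by (auto simp: block_tangent_def N_def)
  have Yc: "cols Y ?C = Y" using GT(1) by (simp add: Y_def cols_def mat_distrib)
  have NY: "transpose N ** Y = 0"
  proof -
    have "transpose N ** cols X ?C = 0"
      using cols_in_block_manifold[OF X, of ?C] by (simp add: block_manifold_def N_def)
    then show ?thesis using GT(2) by (simp add: Y_def mat_distrib)
  qed
  note P = closest_block_polar[OF X Yc NY[unfolded N_def] Z]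
  have X's: "X' \<in> stiefel" unfolding X' N_def by (rule stiefel_of_block[OF X P(1)])
  \<comment> \<open>Outside the block the trial point and \<open>X'\<close> already coincide, so the
    positive factor is completed by the identity there.\<close>
  define K where "K = transpose Y ** Z + sel (- ?C)"
  have psdK: "psd K" unfolding K_def by (rule psd_add_sel[OF P(2)])
  have YK: "X - \<gamma> *\<^sub>R G = X' ** K"
  proof -
    have "sel ?C ** transpose Y = transpose Y"
      by (metis Yc cols_def matrix_transpose_mul transpose_sel)
    then have "N ** (transpose Y ** Z) = X ** sel (- ?C) ** (sel ?C ** transpose Y) ** Z"
      by (simp add: N_def cols_def matrix_mul_assoc)
    then have "N ** (transpose Y ** Z) = 0" by (simp add: matrix_mul_assoc)
    moreover have "Z ** sel (- ?C) = 0" by (simp add: Z_def cols_def)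
    moreover have "N ** sel (- ?C) = N" by (simp add: N_def cols_def)
    moreover have "Z ** (transpose Y ** Z) = Y" using P(3) by simp
    ultimately have "X' ** K = Y + N" by (simp add: X' K_def mat_distrib)
    then show ?thesis using cols_split[of X ?C] by (simp add: Y_def N_def algebra_simps)
  qed
  \<comment> \<open>As \<open>X'\<close> is isometric, \<open>K^2\<close> is the Gram matrix of the
    trial point; the terms linear in the stepsize cancel because \<open>X^T G\<close> is
    skew.\<close>
  have "K ** K = transpose (X' ** K) ** (X' ** K)"
    using psdK X's by (simp add: matrix_transpose_mul psd_def stiefel_def matrix_mul_assoc)
      (simp add: stiefel_def flip: matrix_mul_assoc)
  also have "\<dots> = mat 1 + transpose (\<gamma> *\<^sub>R G) ** (\<gamma> *\<^sub>R G)"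
    using X G(4) by (simp add: mat_distrib stiefel_def scaleR_diff_right flip: YK)
  finally have KK: "K ** K = mat 1 + transpose (\<gamma> *\<^sub>R G) ** (\<gamma> *\<^sub>R G)" .
  note J = psd_sqrt_ge_one[OF psdK KK]
  show "strong_proj (X - \<gamma> *\<^sub>R G) X'" by (rule strong_proj_polar[OF X's YK J(1)])
  have "norm (X' - (X - \<gamma> *\<^sub>R G)) = norm (X' ** (K - mat 1))"
    by (simp add: YK mat_distrib norm_minus_commute)
  also have "\<dots> = norm (K - mat 1)" by (rule norm_isometry_mult[OF X's])
  finally show "2 * norm (X' - (X - \<gamma> *\<^sub>R G)) \<le> \<gamma>\<^sup>2 * (norm G)\<^sup>2"
    using J(2) by (simp add: power_mult_distrib)
qed

section \<open>The averaging operator\<close>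

definition same_block :: "'p set set \<Rightarrow> 'p \<Rightarrow> 'p \<Rightarrow> bool"
  where "same_block \<CC> a b \<longleftrightarrow> (\<exists>B\<in>\<CC>. a \<in> B \<and> b \<in> B)"

definition off_diag :: "'p set set \<Rightarrow> real ^ 'p ^ 'p \<Rightarrow> real ^ 'p ^ 'p"
  where "off_diag \<CC> A = (\<chi> a b. if same_block \<CC> a b then 0 else A $ a $ b)"

lemma linear_off_diag: "linear (off_diag \<CC>)"
  by (rule linearI) (simp_all add: off_diag_def vec_eq_iff)

lemmas off_diag_simps = linear_diff[OF linear_off_diag] linear_add[OF linear_off_diag]
  linear_cmul[OF linear_off_diag] linear_neg[OF linear_off_diag] linear_0[OF linear_off_diag]

lemmas continuous_on_off_diag [continuous_intros] =
  bounded_linear.continuous_on[OF linear_off_diag[unfolded linear_conv_bounded_linear]]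

lemma off_diag_idem [simp]: "off_diag \<CC> (off_diag \<CC> A) = off_diag \<CC> A"
  by (simp add: off_diag_def vec_eq_iff)

lemma inner_off_diag: "off_diag \<CC> A \<bullet> off_diag \<CC> B = off_diag \<CC> A \<bullet> B"
  unfolding inner_vec_def off_diag_def by (intro sum.cong refl) simp

lemma inner_off_diag_commute: "A \<bullet> off_diag \<CC> B = off_diag \<CC> A \<bullet> B"
  by (metis inner_commute inner_off_diag)

lemma norm_off_diag_le: "norm (off_diag \<CC> A) \<le> norm A"
  by (rule power2_le_imp_le) (auto simp: norm_matrix_power2 off_diag_def intro!: sum_mono)

lemma real_choose_2: "real (n choose 2) = real n * (real n - 1) / 2"
proof -
  have "2 dvd n * (n - 1)" by (cases n) auto
  then have "real (n * (n - 1) div 2) = real (n * (n - 1)) / 2"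
    using real_of_nat_div[of 2 "n * (n - 1)"] by simp
  then show ?thesis by (cases n) (auto simp: choose_two algebra_simps)
qed

section \<open>Counting pairs of blocks\<close>

locale column_partition =
  fixes \<CC> :: "'p::finite set set" and l :: nat
  assumes partition: "partition_on UNIV \<CC>" and card_partition: "card \<CC> = l" and two_le: "2 \<le> l"
begin

lemma off_diag_mat [simp]: "off_diag \<CC> (mat c) = 0"
  using partition_onD1[OF partition] by (auto simp: off_diag_def vec_eq_iff mat_def same_block_def)

lemma finite_pairs [simp]: "finite (block_pairs \<CC>)"
  by (simp add: block_pairs_def)

lemma card_pairs: "card (block_pairs \<CC>) = l choose 2"
  by (simp add: block_pairs_def n_subsets card_partition)

lemma card_pairs_pos: "0 < card (block_pairs \<CC>)"
  using two_le by (simp add: card_pairs)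

lemma real_card_pairs: "real (card (block_pairs \<CC>)) = real l * (real l - 1) / 2"
  by (simp add: card_pairs real_choose_2)

lemma block_ex1: "\<exists>!B. B \<in> \<CC> \<and> a \<in> B"
  using partition unfolding partition_on_def disjoint_def by blast

lemma mem_Union_pair_iff:
  assumes "e \<in> block_pairs \<CC>" "B \<in> \<CC>" "a \<in> B"
  shows "a \<in> \<Union>e \<longleftrightarrow> B \<in> e"
  using assms block_ex1[of a] by (auto simp: block_pairs_def)

lemma card_pairs_containing:
  assumes B: "B \<in> \<CC>" shows "card {e \<in> block_pairs \<CC>. B \<in> e} = l - 1"
proof -
  have "bij_betw (\<lambda>B'. {B, B'}) (\<CC> - {B}) {e \<in> block_pairs \<CC>. B \<in> e}"
    unfolding bij_betw_def
  proof (intro conjI equalityI subsetI)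
    show "inj_on (\<lambda>B'. {B, B'}) (\<CC> - {B})" by (auto simp: inj_on_def doubleton_eq_iff)
    fix e assume "e \<in> {e \<in> block_pairs \<CC>. B \<in> e}"
    then have e: "e \<subseteq> \<CC>" "card e = 2" "B \<in> e" by (auto simp: block_pairs_def)
    from e(2) obtain x y where xy: "e = {x, y}" "x \<noteq> y" by (meson card_2_iff)
    have "\<exists>B'\<in>\<CC> - {B}. {x, y} = {B, B'}"
      using e(1,3) xy(2) unfolding xy(1) by (cases "B = x") (auto simp: doubleton_eq_iff)
    then have "\<exists>B'\<in>\<CC> - {B}. e = {B, B'}" unfolding xy(1) .
    then show "e \<in> (\<lambda>B'. {B, B'}) ` (\<CC> - {B})" by blast
  qed (use B in \<open>auto simp: block_pairs_def card_2_iff\<close>)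
  then have "card {e \<in> block_pairs \<CC>. B \<in> e} = card (\<CC> - {B})"
    by (simp add: bij_betw_same_card)
  also have "\<dots> = l - 1" using B by (simp add: card_Diff_singleton card_partition)
  finally show ?thesis .
qed

lemma sum_pairs_one:
  fixes c :: real
  shows "(\<Sum>e\<in>block_pairs \<CC>. if b \<in> \<Union>e then c else 0) = (real l - 1) * c"
proof -
  obtain B where B: "B \<in> \<CC>" "b \<in> B" using block_ex1 by blast
  have "(\<Sum>e\<in>block_pairs \<CC>. if b \<in> \<Union>e then c else 0) = (\<Sum>e\<in>block_pairs \<CC>. if B \<in> e then c else 0)"
    by (intro sum.cong refl) (simp only: mem_Union_pair_iff[OF _ B])
  also have "\<dots> = real (card {e \<in> block_pairs \<CC>. B \<in> e}) * c"
    by (simp add: sum.inter_filter[symmetric])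
  finally show ?thesis using two_le by (simp add: card_pairs_containing[OF B(1)] of_nat_diff)
qed

text \<open>Indices in different blocks are covered only by the pair of their two blocks, indices in
  the same block by every pair containing it. This difference is the source of
  \<open>off_diag\<close> in the averaging operator.\<close>

lemma sum_pairs_two:
  fixes c :: real
  shows "(\<Sum>e\<in>block_pairs \<CC>. if a \<in> \<Union>e \<and> b \<in> \<Union>e then c else 0)
    = (if same_block \<CC> a b then (real l - 1) * c else c)"
proof -
  obtain A where A: "A \<in> \<CC>" "a \<in> A" using block_ex1 by blast
  obtain B where B: "B \<in> \<CC>" "b \<in> B" using block_ex1 by blast
  have s: "same_block \<CC> a b \<longleftrightarrow> A = B"
    using A B block_ex1[of a] block_ex1[of b] by (auto simp: same_block_def)
  have *: "(\<Sum>e\<in>block_pairs \<CC>. if a \<in> \<Union>e \<and> b \<in> \<Union>e then c else 0)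
      = (\<Sum>e\<in>block_pairs \<CC>. if A \<in> e \<and> B \<in> e then c else 0)"
    by (intro sum.cong refl) (simp only: mem_Union_pair_iff[OF _ A] mem_Union_pair_iff[OF _ B])
  also have "\<dots> = real (card {e \<in> block_pairs \<CC>. A \<in> e \<and> B \<in> e}) * c"
    by (simp add: sum.inter_filter[symmetric])
  finally have *: "(\<Sum>e\<in>block_pairs \<CC>. if a \<in> \<Union>e \<and> b \<in> \<Union>e then c else 0)
    = real (card {e \<in> block_pairs \<CC>. A \<in> e \<and> B \<in> e}) * c" .
  show ?thesis
  proof (cases "A = B")
    case True
    then show ?thesis using * s two_le by (simp add: card_pairs_containing[OF B(1)] of_nat_diff)
  next
    case False
    have uniq: "e = {A, B}" if "card e = 2" "A \<in> e" "B \<in> e" for e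
      using that False unfolding card_2_iff by blast
    have two: "card {A, B} = 2" using False by simp
    have "{e \<in> block_pairs \<CC>. A \<in> e \<and> B \<in> e} = {{A, B}}"
    proof (intro set_eqI iffI)
      fix e assume "e \<in> {e \<in> block_pairs \<CC>. A \<in> e \<and> B \<in> e}"
      then show "e \<in> {{A, B}}" using uniq[of e] by (simp add: block_pairs_def)
    next
      fix e assume "e \<in> {{A, B}}"
      then show "e \<in> {e \<in> block_pairs \<CC>. A \<in> e \<and> B \<in> e}"
        using A(1) B(1) two by (simp add: block_pairs_def)
    qed
    then show ?thesis using * s False by simp
  qed
qed

lemma sum_mult_sel: "(\<Sum>e\<in>block_pairs \<CC>. A ** sel (\<Union>e)) = (real l - 1) *\<^sub>R A" for A :: "real ^ 'p ^ 'n"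
  by (simp only: vec_eq_iff sum_component sel_mult_right sum_pairs_one) simp

lemma sum_norm_mult_sel:
  "(\<Sum>e\<in>block_pairs \<CC>. (norm (A ** sel (\<Union>e)))\<^sup>2) = (real l - 1) * (norm A)\<^sup>2" for A :: "real ^ 'p ^ 'n"
proof -
  have "(\<Sum>e\<in>block_pairs \<CC>. (norm (A ** sel (\<Union>e)))\<^sup>2)
      = (\<Sum>i\<in>UNIV. \<Sum>j\<in>UNIV. \<Sum>e\<in>block_pairs \<CC>. if j \<in> \<Union>e then (A $ i $ j)\<^sup>2 else 0)"
    unfolding norm_matrix_power2 sel_mult_right
    by (subst sum.swap, rule sum.cong[OF refl], subst sum.swap) (intro sum.cong refl, simp)
  then show ?thesis by (simp only: sum_pairs_one norm_matrix_power2 sum_distrib_left)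
qed

lemma sum_sel_mult_sel:
  "(\<Sum>e\<in>block_pairs \<CC>. sel (\<Union>e) ** A ** sel (\<Union>e)) = (real l - 1) *\<^sub>R A - (real l - 2) *\<^sub>R off_diag \<CC> A"
proof -
  have "(\<Sum>e\<in>block_pairs \<CC>. sel (\<Union>e) ** A ** sel (\<Union>e)) $ a $ b
     = (\<Sum>e\<in>block_pairs \<CC>. if a \<in> \<Union>e \<and> b \<in> \<Union>e then A $ a $ b else 0)" for a b
    unfolding sum_component by (intro sum.cong refl) (simp add: sel_mult_left sel_mult_right)
  then show ?thesis unfolding sum_pairs_two by (simp add: vec_eq_iff off_diag_def algebra_simps)
qed

text \<open>Every off-diagonal entry survives in exactly one pair, so the squares add up to one copy
  and not to \<open>l - 1\<close> copies.\<close>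

lemma sum_norm_off_diag_sel:
  "(\<Sum>e\<in>block_pairs \<CC>. (norm (off_diag \<CC> (sel (\<Union>e) ** A ** sel (\<Union>e))))\<^sup>2) = (norm (off_diag \<CC> A))\<^sup>2"
proof -
  have "(\<Sum>e\<in>block_pairs \<CC>. (norm (off_diag \<CC> (sel (\<Union>e) ** A ** sel (\<Union>e))))\<^sup>2)
      = (\<Sum>i\<in>UNIV. \<Sum>j\<in>UNIV. \<Sum>e\<in>block_pairs \<CC>. if i \<in> \<Union>e \<and> j \<in> \<Union>e then (off_diag \<CC> A $ i $ j)\<^sup>2 else 0)"
    unfolding norm_matrix_power2
    by (subst sum.swap, rule sum.cong[OF refl], subst sum.swap)
       (intro sum.cong refl, simp add: off_diag_def sel_mult_left sel_mult_right)
  also have "\<dots> = (norm (off_diag \<CC> A))\<^sup>2"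
    unfolding sum_pairs_two norm_matrix_power2 by (intro sum.cong refl) (simp add: off_diag_def)
  finally show ?thesis .
qed

text \<open>Writing the complementary selection as identity minus selection leaves three countable
  sums. The multiples of \<open>X X^T \<xi>\<close> cancel, and only the off-diagonal deficit
  remains.\<close>

lemma sum_block_proj:
  fixes \<xi> :: "real ^ 'p ^ 'n"
  shows "(\<Sum>e\<in>block_pairs \<CC>. block_proj X (\<Union>e) \<xi>)
    = (real l - 1) *\<^sub>R \<xi> - (real l - 2) *\<^sub>R (X ** off_diag \<CC> (transpose X ** \<xi>))"
proof -
  let ?A = "transpose X ** \<xi>"
  have "block_proj X C \<xi> = \<xi> ** sel C - X ** (?A ** sel C) + X ** (sel C ** ?A ** sel C)" for C
  proof -
    have "sel (- C) = mat 1 - sel C" using sel_Compl_add[of C] by (simp add: algebra_simps)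
    then show ?thesis by (simp add: block_proj_eq mat_distrib matrix_mul_assoc)
  qed
  then have "(\<Sum>e\<in>block_pairs \<CC>. block_proj X (\<Union>e) \<xi>)
      = (\<Sum>e\<in>block_pairs \<CC>. \<xi> ** sel (\<Union>e)) - X ** (\<Sum>e\<in>block_pairs \<CC>. ?A ** sel (\<Union>e))
        + X ** (\<Sum>e\<in>block_pairs \<CC>. sel (\<Union>e) ** ?A ** sel (\<Union>e))"
    by (simp add: sum.distrib sum_subtractf matmul.sum_right)
  then show ?thesis unfolding sum_mult_sel sum_sel_mult_sel by (simp add: mat_distrib)
qed

section \<open>The inverse averaging operator and its metric\<close>

lemma avg_op_eq:
  fixes X \<xi> :: "real ^ 'p ^ 'n"
  shows "avg_op \<CC> X \<xi> = (2 / (real l * (real l - 1))) *\<^sub>R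
    ((real l - 1) *\<^sub>R \<xi> - (real l - 2) *\<^sub>R (X ** off_diag \<CC> (transpose X ** \<xi>)))"
  unfolding avg_op_def block_proj_def[symmetric] sum_block_proj card_partition real_choose_2 by simp

text \<open>The map \<open>\<xi> -> X off (X^T \<xi>)\<close> is an orthogonal projection. The
  averaging operator acts as \<open>2 / l\<close> on its kernel and as
  \<open>2 / (l (l - 1))\<close> on its range; the right-hand side has the reciprocal
  values.\<close>

lemma inv_avg_op:
  fixes X :: "real ^ 'p ^ 'n"
  assumes X: "X \<in> stiefel"
  shows "inv (avg_op \<CC> X) \<eta> = (real l / 2) *\<^sub>R (\<eta> + (real l - 2) *\<^sub>R (X ** off_diag \<CC> (transpose X ** \<eta>)))"
proof -
  define B where "B = (\<lambda>\<eta>. (real l / 2) *\<^sub>R (\<eta> + (real l - 2) *\<^sub>R (X ** off_diag \<CC> (transpose X ** \<eta>))))"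
  have XX: "transpose X ** (X ** A) = A" for A :: "real ^ 'p ^ 'p"
    using X by (simp add: matrix_mul_assoc stiefel_def)
  have l: "real l > 1" "real l - 1 \<noteq> 0" "real l \<noteq> 0" using two_le by auto
  have 1: "avg_op \<CC> X (B \<eta>) = \<eta>" for \<eta>
  proof -
    define A where "A = off_diag \<CC> (transpose X ** \<eta>)"
    define Q where "Q = X ** A"
    have "off_diag \<CC> (transpose X ** B \<eta>) = (real l / 2) *\<^sub>R (A + (real l - 2) *\<^sub>R A)"
      by (simp add: B_def mat_distrib off_diag_simps XX A_def)
    also have "\<dots> = (real l / 2 * (real l - 1)) *\<^sub>R A"
      by (simp add: vec_eq_iff field_simps)
    finally have "avg_op \<CC> X (B \<eta>) = (2 / (real l * (real l - 1))) *\<^sub>R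
        ((real l - 1) *\<^sub>R (real l / 2) *\<^sub>R (\<eta> + (real l - 2) *\<^sub>R Q) - ((real l - 2) * (real l / 2 * (real l - 1))) *\<^sub>R Q)"
      by (simp add: avg_op_eq matmul.scaleR_right) (simp add: B_def A_def Q_def)
    also have "\<dots> = \<eta>" using l by (simp add: vec_eq_iff divide_simps) (simp add: algebra_simps)
    finally show ?thesis .
  qed
  have 2: "B (avg_op \<CC> X \<xi>) = \<xi>" for \<xi>
  proof -
    define A where "A = off_diag \<CC> (transpose X ** \<xi>)"
    define Q where "Q = X ** A"
    define c where "c = 2 / (real l * (real l - 1))"
    have "off_diag \<CC> (transpose X ** avg_op \<CC> X \<xi>) = c *\<^sub>R ((real l - 1) *\<^sub>R A - (real l - 2) *\<^sub>R A)"
      by (simp add: avg_op_eq mat_distrib off_diag_simps XX A_def c_def)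
    also have "\<dots> = c *\<^sub>R A"
      by (simp add: vec_eq_iff field_simps)
    finally have "B (avg_op \<CC> X \<xi>) = (real l / 2) *\<^sub>R (c *\<^sub>R ((real l - 1) *\<^sub>R \<xi> - (real l - 2) *\<^sub>R Q) + (real l - 2) *\<^sub>R (c *\<^sub>R Q))"
      unfolding B_def by (simp add: matmul.scaleR_right) (simp add: avg_op_eq A_def Q_def c_def)
    also have "\<dots> = \<xi>" using l by (simp add: vec_eq_iff c_def divide_simps) (simp add: algebra_simps)
    finally show ?thesis .
  qed
  have "inv (avg_op \<CC> X) = B"
    using 1 2 by (intro inv_unique_comp) auto
  then show ?thesis by (simp add: B_def)
qed

text \<open>The quadratic form of the inverse operator with the inverse computed. It is polynomial
  in the entries of both arguments, so its continuity is immediate.\<close>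

definition metric_sq :: "real ^ 'p ^ 'n \<Rightarrow> real ^ 'p ^ 'n \<Rightarrow> real"
  where "metric_sq X \<xi> = real l / 2 * ((norm \<xi>)\<^sup>2 + (real l - 2) * (norm (off_diag \<CC> (transpose X ** \<xi>)))\<^sup>2)"

lemma metric_sq_nonneg: "0 \<le> metric_sq X \<xi>"
  using two_le by (simp add: metric_sq_def)

lemma avg_inv_norm_sq:
  assumes X: "X \<in> stiefel"
  shows "(avg_inv_norm \<CC> X \<xi>)\<^sup>2 = metric_sq X \<xi>"
proof -
  have "inv (avg_op \<CC> X) \<xi> \<bullet> \<xi> = metric_sq X \<xi>"
    by (simp add: inv_avg_op[OF X] metric_sq_def inner_add_left inner_matrix_mult_left power2_norm_eq_inner
        inner_off_diag)
  then show ?thesis using metric_sq_nonneg by (simp add: avg_inv_norm_def)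
qed

text \<open>The identity matrix \<open>Z^T Z\<close> has no off-diagonal blocks. The change of
  metric along a step is thereby reduced to the change of \<open>Z^T W\<close>.\<close>

lemma metric_sq_diff:
  fixes W Z :: "real ^ 'p ^ 'n"
  assumes Z: "Z \<in> stiefel"
  shows "metric_sq Z (W - Z) = real l / 2 * ((norm (W - Z))\<^sup>2 + (real l - 2) * (norm (off_diag \<CC> (transpose Z ** W)))\<^sup>2)"
  using Z by (simp add: metric_sq_def mat_distrib off_diag_simps stiefel_def)

end

section \<open>One-step estimate\<close>

text \<open>Young's inequality with weights \<open>1 + 2\<close> and \<open>1 + 1/2\<close>. The
  smaller weight is meant for the term in \<open>norm U\<close>, whose share of the final constant
  \<open>2 l - 3\<close> leaves no slack.\<close>

lemma norm_add_sq_le: "(norm (a + b))\<^sup>2 \<le> 3 * (norm a)\<^sup>2 + 3 / 2 * (norm b)\<^sup>2"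
  for a b :: "'a::real_inner"
proof -
  have "0 \<le> (norm (2 *\<^sub>R a - b))\<^sup>2" by simp
  then show ?thesis
    by (simp add: power2_norm_eq_inner inner_add_left inner_add_right inner_diff_left inner_diff_right inner_commute)
qed

lemma norm_diff_sq_le: "(norm (a - b))\<^sup>2 \<le> 2 * (norm a)\<^sup>2 + 2 * (norm b)\<^sup>2"
  for a b :: "'a::real_inner"
proof -
  have "0 \<le> (norm (a + b))\<^sup>2" by simp
  then show ?thesis
    by (simp add: power2_norm_eq_inner inner_add_left inner_add_right inner_diff_left inner_diff_right inner_commute)
qed

lemma norm_transpose_mult_le:
  assumes "X \<in> stiefel" shows "norm (transpose X ** A) \<le> norm A"
  using norm_mult_transpose_stiefel_le[OF assms, of A]
  by (metis matrix_transpose_mul norm_transpose transpose_transpose)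

text \<open>Equal Gram matrices make a secant of the manifold tangent up to a term quadratic in its
  length.\<close>

lemma sym_part_stiefel_diff:
  assumes "X \<in> stiefel" "W \<in> stiefel"
  shows "sym_part (transpose X ** (W - X)) = - (1 / 2) *\<^sub>R (transpose (W - X) ** (W - X))"
  using assms by (simp add: sym_part_def stiefel_def mat_distrib matrix_transpose_mul algebra_simps)

lemma norm_tangent_grad_le:
  assumes "X \<in> stiefel" shows "norm (tangent_grad X D) \<le> norm D"
proof (rule power2_le_imp_le)
  show "(norm (tangent_grad X D))\<^sup>2 \<le> (norm D)\<^sup>2" using tangent_grad_pythagoras[OF assms, of D] by simp
qed simp

text \<open>The curvature error of replacing the subgradient by its tangent part: the normal part is
  \<open>X S\<close> with \<open>S\<close> symmetric, so it sees only the symmetric part of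
  \<open>X^T (W - X)\<close>, which is quadratic.\<close>

lemma inner_tangent_grad_le:
  assumes X: "X \<in> stiefel" and W: "W \<in> stiefel" and D: "norm D \<le> L"
  shows "(W - X) \<bullet> tangent_grad X D \<le> D \<bullet> (W - X) + L / 2 * (norm (W - X))\<^sup>2"
proof -
  define U where "U = W - X"
  define S where "S = sym_part (transpose X ** D)"
  have tS: "transpose S = S" by (simp add: S_def)
  have "norm S \<le> norm D"
  proof (rule power2_le_imp_le)
    show "(norm S)\<^sup>2 \<le> (norm D)\<^sup>2" using tangent_grad_pythagoras[OF X, of D] by (simp add: S_def)
  qed simp
  then have nS: "norm S \<le> L" using D by simp
  have "U \<bullet> (X ** S) = (transpose X ** U) \<bullet> S"
    by (subst inner_commute, subst inner_matrix_mult_left) (rule inner_commute)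
  also have "\<dots> = - (1 / 2) * ((transpose U ** U) \<bullet> S)"
    using inner_sym_part[OF tS, of "transpose X ** U"] sym_part_stiefel_diff[OF X W] by (simp add: U_def)
  finally have "U \<bullet> tangent_grad X D = D \<bullet> U + 1 / 2 * ((transpose U ** U) \<bullet> S)"
    by (simp add: tangent_grad_def inner_diff_right S_def[symmetric] inner_commute)
  also have "(transpose U ** U) \<bullet> S \<le> (norm U * norm U) * L"
  proof -
    have "(transpose U ** U) \<bullet> S \<le> norm (transpose U ** U) * norm S" by (rule norm_cauchy_schwarz)
    also have "\<dots> \<le> (norm U * norm U) * L"
      using norm_matrix_mult_le[of "transpose U" U] nS by (intro mult_mono) auto
    finally show ?thesis .
  qed
  finally show ?thesis by (simp add: U_def power2_eq_square mult_ac)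
qed

context column_partition
begin

text \<open>The Euclidean part uses nonexpansiveness towards \<open>W\<close>, which leaves no
  remainder from the projection. The off-diagonal part expands \<open>Z^T W\<close> around
  \<open>X^T W\<close>. Terms linear in \<open>G\<close> are kept exact, since their cancellation
  shows only after summation over the pairs; \<open>x\<close> is kept apart from
  \<open>norm G\<close> because its squares have a smaller sum.\<close>

lemma metric_sq_step_le:
  fixes X W D Z :: "real ^ 'p ^ 'n"
  assumes X: "X \<in> stiefel" and W: "W \<in> stiefel" and step: "rssm_step \<gamma> e D X Z"
    and D: "norm D \<le> L" and \<gamma>: "0 \<le> \<gamma>"
  defines "G \<equiv> block_proj X (\<Union>e) (tangent_grad X D)"
    and "U \<equiv> W - X" and "Off \<equiv> off_diag \<CC> (transpose X ** W)"
    and "x \<equiv> norm (off_diag \<CC> (sel (\<Union>e) ** (transpose X ** tangent_grad X D) ** sel (\<Union>e)))"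
  shows "metric_sq Z (W - Z) \<le> real l / 2 * ((norm U)\<^sup>2 + (real l - 2) * (norm Off)\<^sup>2
      + 2 * \<gamma> * (U \<bullet> G + (real l - 2) * (Off \<bullet> (transpose X ** G)))
      - 2 * \<gamma> * (real l - 2) * (Off \<bullet> (transpose G ** U))
      + \<gamma>\<^sup>2 * (norm G)\<^sup>2 * (1 + (real l - 2) * (norm Off + 3 / 2 * (norm U)\<^sup>2 + 3 / 2 * \<gamma>\<^sup>2 * L\<^sup>2))
      + 6 * (real l - 2) * \<gamma>\<^sup>2 * x\<^sup>2)"
proof -
  define Y where "Y = X - \<gamma> *\<^sub>R G"
  have pol: "strong_proj Y Z" and R0: "2 * norm (Z - Y) \<le> \<gamma>\<^sup>2 * (norm G)\<^sup>2"
    using rssm_step_strong_proj[OF X step] by (simp_all add: Y_def G_def)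
  then have Z: "Z \<in> stiefel" by (simp add: strong_proj_def)
  define R where "R = Z - Y"
  define \<Delta> where "\<Delta> = Z - X"
  have \<Delta>R: "\<Delta> = R - \<gamma> *\<^sub>R G" by (simp add: R_def \<Delta>_def Y_def)
  have R: "norm R \<le> \<gamma>\<^sup>2 * (norm G)\<^sup>2 / 2" using R0 by (simp add: R_def)
  have n\<Delta>: "norm \<Delta> \<le> \<gamma> * norm G"
    using strong_proj_nonexpansive[OF pol strong_proj_self[OF X]] \<gamma> by (simp add: \<Delta>_def Y_def)
  have "norm (Z - W) \<le> norm (Y - W)"
    by (rule strong_proj_nonexpansive[OF pol strong_proj_self[OF W]])
  then have "(norm (W - Z))\<^sup>2 \<le> (norm (U + \<gamma> *\<^sub>R G))\<^sup>2"
    by (intro power_mono) (simp_all add: norm_minus_commute U_def Y_def algebra_simps)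
  also have "\<dots> = (norm U)\<^sup>2 + 2 * \<gamma> * (U \<bullet> G) + \<gamma>\<^sup>2 * (norm G)\<^sup>2"
    unfolding power2_norm_eq_inner
    by (simp add: inner_add_left inner_add_right inner_commute power2_eq_square algebra_simps)
  finally have I: "(norm (W - Z))\<^sup>2 \<le> (norm U)\<^sup>2 + 2 * \<gamma> * (U \<bullet> G) + \<gamma>\<^sup>2 * (norm G)\<^sup>2" .

  have nG: "norm G \<le> L"
  proof -
    have "norm G \<le> norm (tangent_grad X D)"
      unfolding G_def by (rule order_trans[OF norm_block_proj_le[OF X] norm_mult_sel_le])
    also have "\<dots> \<le> norm D"
      by (rule norm_tangent_grad_le[OF X])
    finally show ?thesis using D by simp
  qed
  define Q where "Q = off_diag \<CC> (transpose \<Delta> ** W)"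
  have ZW: "off_diag \<CC> (transpose Z ** W) = Off + Q"
    by (simp add: Off_def Q_def \<Delta>_def mat_distrib off_diag_simps)
  have GX: "transpose G ** X = - (transpose X ** G)"
    unfolding G_def by (rule closest_block_tangent(4)[OF X])
  \<comment> \<open>With \<open>W = X + U\<close> and \<open>X^T G\<close> skew,
    \<open>G^T W\<close> splits into \<open>- X^T G\<close>, which belongs to the averaged gradient,
    and the error \<open>G^T U\<close>.\<close>
  have OffQ: "Off \<bullet> Q \<le> norm Off * (\<gamma>\<^sup>2 * (norm G)\<^sup>2 / 2) + \<gamma> * (Off \<bullet> (transpose X ** G)) - \<gamma> * (Off \<bullet> (transpose G ** U))"
  proof -
    have "Off \<bullet> Q = Off \<bullet> (transpose \<Delta> ** W)"
      by (simp add: Q_def Off_def inner_off_diag)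
    also have "\<dots> = Off \<bullet> (transpose R ** W) - \<gamma> * (Off \<bullet> (transpose G ** W))"
      by (simp add: \<Delta>R mat_distrib inner_diff_right)
    also have "transpose G ** W = transpose G ** U - transpose X ** G"
      by (simp add: U_def mat_distrib GX)
    also have "Off \<bullet> (transpose R ** W) \<le> norm Off * norm (transpose R ** W)"
      by (rule norm_cauchy_schwarz)
    also have "\<dots> \<le> norm Off * (\<gamma>\<^sup>2 * (norm G)\<^sup>2 / 2)"
      using norm_mult_transpose_stiefel_le[OF W, of R] R by (intro mult_left_mono) auto
    finally show ?thesis by (simp add: inner_diff_right algebra_simps)
  qed
  \<comment> \<open>The part of \<open>Q\<close> tested against \<open>X\<close> contains the skew
    block of \<open>G\<close> and the projection remainder, each doubled; times the weight 3 this
    gives 6 and \<open>3 * 2 / 4 = 3 / 2\<close>.\<close>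
  have nQ: "(norm Q)\<^sup>2 \<le> 6 * \<gamma>\<^sup>2 * x\<^sup>2 + 3 / 2 * \<gamma>\<^sup>2 * (norm G)\<^sup>2 * (norm U)\<^sup>2 + 3 / 2 * \<gamma>\<^sup>2 * (norm G)\<^sup>2 * (\<gamma>\<^sup>2 * L\<^sup>2)"
  proof -
    let ?a = "off_diag \<CC> (transpose \<Delta> ** X)" and ?b = "off_diag \<CC> (transpose \<Delta> ** U)"
    have "Q = ?a + ?b" by (simp add: Q_def U_def mat_distrib off_diag_simps)
    then have 1: "(norm Q)\<^sup>2 \<le> 3 * (norm ?a)\<^sup>2 + 3 / 2 * (norm ?b)\<^sup>2"
      using norm_add_sq_le[of ?a ?b] by simp
    have "norm ?b \<le> \<gamma> * norm G * norm U"
      using norm_off_diag_le[of \<CC> "transpose \<Delta> ** U"] norm_matrix_mult_le[of "transpose \<Delta>" U]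
        mult_right_mono[OF n\<Delta>, of "norm U"] by simp
    from power_mono[OF this norm_ge_zero, of 2]
    have 2: "(norm ?b)\<^sup>2 \<le> \<gamma>\<^sup>2 * (norm G)\<^sup>2 * (norm U)\<^sup>2"
      by (simp add: power_mult_distrib)
    have "?a = off_diag \<CC> (transpose R ** X) - \<gamma> *\<^sub>R off_diag \<CC> (transpose G ** X)"
      by (simp add: \<Delta>R mat_distrib off_diag_simps)
    then have 3: "(norm ?a)\<^sup>2 \<le> 2 * (norm (off_diag \<CC> (transpose R ** X)))\<^sup>2 + 2 * (norm (\<gamma> *\<^sub>R off_diag \<CC> (transpose G ** X)))\<^sup>2"
      by (simp only: norm_diff_sq_le)
    have "off_diag \<CC> (transpose G ** X) = - off_diag \<CC> (sel (\<Union>e) ** (transpose X ** tangent_grad X D) ** sel (\<Union>e))"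
      unfolding GX using closest_block_tangent(3)[OF X, of "\<Union>e" D] by (simp add: G_def off_diag_simps)
    then have 4: "(norm (\<gamma> *\<^sub>R off_diag \<CC> (transpose G ** X)))\<^sup>2 = \<gamma>\<^sup>2 * x\<^sup>2"
      by (simp add: x_def power_mult_distrib)
    have "norm (off_diag \<CC> (transpose R ** X)) \<le> \<gamma>\<^sup>2 * (norm G)\<^sup>2 / 2"
      using norm_off_diag_le[of \<CC> "transpose R ** X"] norm_mult_transpose_stiefel_le[OF X, of R] R by linarith
    then have "(norm (off_diag \<CC> (transpose R ** X)))\<^sup>2 \<le> (\<gamma>\<^sup>2 * (norm G)\<^sup>2 / 2)\<^sup>2"
      by (intro power_mono) auto
    also have "\<dots> = \<gamma>\<^sup>2 * (norm G)\<^sup>2 * (\<gamma>\<^sup>2 * (norm G)\<^sup>2) / 4"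
      by (simp add: power2_eq_square)
    also have "\<dots> \<le> \<gamma>\<^sup>2 * (norm G)\<^sup>2 * (\<gamma>\<^sup>2 * L\<^sup>2) / 4"
      using nG by (intro divide_right_mono mult_left_mono power_mono) auto
    finally show ?thesis using 1 2 3 4 by linarith
  qed
  have "(norm (Off + Q))\<^sup>2 = (norm Off)\<^sup>2 + 2 * (Off \<bullet> Q) + (norm Q)\<^sup>2"
    by (simp add: power2_norm_eq_inner inner_add_left inner_add_right inner_commute)
  then have II: "(norm (Off + Q))\<^sup>2 \<le> (norm Off)\<^sup>2
      + 2 * (norm Off * (\<gamma>\<^sup>2 * (norm G)\<^sup>2 / 2) + \<gamma> * (Off \<bullet> (transpose X ** G)) - \<gamma> * (Off \<bullet> (transpose G ** U)))
      + (6 * \<gamma>\<^sup>2 * x\<^sup>2 + 3 / 2 * \<gamma>\<^sup>2 * (norm G)\<^sup>2 * (norm U)\<^sup>2 + 3 / 2 * \<gamma>\<^sup>2 * (norm G)\<^sup>2 * (\<gamma>\<^sup>2 * L\<^sup>2))"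
    by (simp only:) (intro add_mono mult_left_mono OffQ nQ order_refl; simp)
  have l2: "0 \<le> real l - 2" using two_le by simp
  have "metric_sq Z (W - Z) = real l / 2 * ((norm (W - Z))\<^sup>2 + (real l - 2) * (norm (Off + Q))\<^sup>2)"
    by (simp add: metric_sq_diff[OF Z] ZW)
  also have "\<dots> \<le> real l / 2 * (((norm U)\<^sup>2 + 2 * \<gamma> * (U \<bullet> G) + \<gamma>\<^sup>2 * (norm G)\<^sup>2) + (real l - 2) * ((norm Off)\<^sup>2
      + 2 * (norm Off * (\<gamma>\<^sup>2 * (norm G)\<^sup>2 / 2) + \<gamma> * (Off \<bullet> (transpose X ** G)) - \<gamma> * (Off \<bullet> (transpose G ** U)))
      + (6 * \<gamma>\<^sup>2 * x\<^sup>2 + 3 / 2 * \<gamma>\<^sup>2 * (norm G)\<^sup>2 * (norm U)\<^sup>2 + 3 / 2 * \<gamma>\<^sup>2 * (norm G)\<^sup>2 * (\<gamma>\<^sup>2 * L\<^sup>2))))"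
    by (intro mult_left_mono add_mono I II l2) auto
  finally show ?thesis by (simp add: algebra_simps)
qed


text \<open>Summation over all possible draws from one state. Below, \<open>n = l - 2\<close> and
  \<open>g\<close> is the stepsize times \<open>L\<close>, so \<open>g <= 1\<close> lets higher
  powers of \<open>g\<close> be traded for lower ones.\<close>

lemma sum_metric_sq_step_le:
  fixes X W D :: "real ^ 'p ^ 'n" and Z :: "'p set set \<Rightarrow> real ^ 'p ^ 'n"
  assumes X: "X \<in> stiefel" and W: "W \<in> stiefel" and D: "norm D \<le> L"
    and step: "\<And>e. e \<in> block_pairs \<CC> \<Longrightarrow> rssm_step \<gamma> e D X (Z e)"
    and \<gamma>: "0 \<le> \<gamma>" "\<gamma> * L \<le> 1"
  defines "U \<equiv> W - X"
  shows "(\<Sum>e\<in>block_pairs \<CC>. metric_sq (Z e) (W - Z e)) \<le> real (card (block_pairs \<CC>)) *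
    (metric_sq X U + 2 * \<gamma> * (D \<bullet> U) + 2 * \<gamma> * (2 * real l - 3) * L * metric_sq X U / real l
      + 9 * \<gamma>\<^sup>2 * L\<^sup>2 + 4 * (real l - 2) * \<gamma> ^ 3 * L ^ 3 + (real l - 2) * \<gamma> ^ 4 * L ^ 4)"
proof -
  let ?P = "block_pairs \<CC>"
  define Dt where "Dt = tangent_grad X D"
  define A where "A = transpose X ** Dt"
  define G where "G e = block_proj X (\<Union>e) Dt" for e
  define Off where "Off = off_diag \<CC> (transpose X ** W)"
  define x where "x e = norm (off_diag \<CC> (sel (\<Union>e) ** A ** sel (\<Union>e)))" for e
  define SG where "SG = (\<Sum>e\<in>?P. G e)"
  define n u o' g where "n = real l - 2" and "u = norm U" and "o' = norm Off" and "g = \<gamma> * L"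
  define N where "N = real (card ?P)"
  have L0: "0 \<le> L" using D norm_ge_zero[of D] by linarith
  have n0: "0 \<le> n" and u0: "0 \<le> u" and o0: "0 \<le> o'" and g0: "0 \<le> g"
    using two_le L0 \<gamma> by (simp_all add: n_def u_def o'_def g_def)
  have l: "real l = n + 2" by (simp add: n_def)
  have N: "N = (n + 2) * (n + 1) / 2" using real_card_pairs by (simp add: N_def l)
  have OffU: "Off = off_diag \<CC> (transpose X ** U)"
    using X by (simp add: Off_def U_def mat_distrib off_diag_simps stiefel_def)
  have q: "metric_sq X U = (n + 2) / 2 * (u\<^sup>2 + n * o'\<^sup>2)"
    by (simp add: metric_sq_def l OffU u_def o'_def)
  have nDt: "norm Dt \<le> L" using norm_tangent_grad_le[OF X, of D] D by (simp add: Dt_def)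
  have SG: "SG = (n + 1) *\<^sub>R Dt - n *\<^sub>R (X ** off_diag \<CC> A)"
    unfolding SG_def G_def sum_block_proj by (simp add: l A_def)

  \<comment> \<open>Up to scaling this is the inner product of the inverse operator at
    \<open>U\<close> with the operator at \<open>Dt\<close>. The metric is made for this
    cancellation, which leaves the plain inner product.\<close>
  have lin1: "(\<Sum>e\<in>?P. U \<bullet> G e + n * (Off \<bullet> (transpose X ** G e))) = (n + 1) * (U \<bullet> Dt)"
  proof -
    have s1: "(\<Sum>e\<in>?P. U \<bullet> G e + n * (Off \<bullet> (transpose X ** G e))) = U \<bullet> SG + n * (Off \<bullet> (transpose X ** SG))"
      by (simp add: SG_def sum.distrib inner_sum_right matmul.sum_right sum_distrib_left)
    have s2: "U \<bullet> (X ** off_diag \<CC> A) = Off \<bullet> A"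
    proof -
      have "U \<bullet> (X ** off_diag \<CC> A) = off_diag \<CC> A \<bullet> (transpose X ** U)"
        by (subst inner_commute, subst inner_matrix_mult_left) (rule refl)
      then show ?thesis by (metis OffU inner_commute inner_off_diag_commute)
    qed
    have s3: "transpose X ** SG = (n + 1) *\<^sub>R A - n *\<^sub>R off_diag \<CC> A"
      using X by (simp add: SG mat_distrib A_def matrix_mul_assoc stiefel_def)
    have s4: "Off \<bullet> off_diag \<CC> A = Off \<bullet> A" by (simp add: Off_def inner_off_diag)
    show ?thesis unfolding s1 s3 unfolding SG inner_diff_right inner_scaleR_right s2 s4 by (simp add: algebra_simps)
  qed
  have lin1': "(n + 1) * (U \<bullet> Dt) \<le> (n + 1) * (D \<bullet> U + L / 2 * u\<^sup>2)"
    using inner_tangent_grad_le[OF X W D] n0 by (intro mult_left_mono) (simp_all add: U_def Dt_def u_def)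
  \<comment> \<open>The operator sending \<open>Dt\<close> to \<open>SG\<close> acts as
    \<open>n + 1\<close> on one subspace and as 1 on its complement. Bounding each pair separately
    would lose a factor \<open>l / 2\<close>.\<close>
  have nSG: "norm SG \<le> (n + 1) * L"
  proof -
    let ?B = "off_diag \<CC> A"
    have DX: "Dt \<bullet> (X ** ?B) = ?B \<bullet> ?B"
    proof -
      have "Dt \<bullet> (X ** ?B) = ?B \<bullet> A"
        by (subst inner_commute, subst inner_matrix_mult_left) (simp add: A_def)
      then show ?thesis by (simp add: inner_off_diag)
    qed
    have XB: "(X ** ?B) \<bullet> (X ** ?B) = ?B \<bullet> ?B"
      using norm_isometry_mult[OF X, of ?B] by (simp add: norm_eq_sqrt_inner)
    have "(norm SG)\<^sup>2 = (n + 1)\<^sup>2 * (Dt \<bullet> Dt) - (2 * (n + 1) * n - n\<^sup>2) * (?B \<bullet> ?B)"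
      unfolding SG power2_norm_eq_inner
      by (simp add: inner_diff_left inner_diff_right DX XB inner_commute[of "X ** ?B" Dt] power2_eq_square algebra_simps)
    also have "\<dots> \<le> (n + 1)\<^sup>2 * (Dt \<bullet> Dt)"
    proof -
      have "0 \<le> 2 * (n + 1) * n - n\<^sup>2" using n0 by (simp add: power2_eq_square algebra_simps)
      then have "0 \<le> (2 * (n + 1) * n - n\<^sup>2) * (?B \<bullet> ?B)" by simp
      then show ?thesis by linarith
    qed
    also have "\<dots> = ((n + 1) * norm Dt)\<^sup>2" by (simp add: power_mult_distrib power2_norm_eq_inner)
    finally have "norm SG \<le> (n + 1) * norm Dt" by (rule power2_le_imp_le) (use n0 in simp)
    also have "\<dots> \<le> (n + 1) * L" using nDt n0 by (intro mult_left_mono) auto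
    finally show ?thesis .
  qed
  have lin2: "- (\<Sum>e\<in>?P. Off \<bullet> (transpose (G e) ** U)) \<le> (n + 1) * L * u * o'"
  proof -
    have "(\<Sum>e\<in>?P. Off \<bullet> (transpose (G e) ** U)) = Off \<bullet> (transpose SG ** U)"
      by (simp add: SG_def linear_sum[OF linear_transpose] matmul.sum_left inner_sum_right)
    moreover have "\<bar>Off \<bullet> (transpose SG ** U)\<bar> \<le> o' * norm (transpose SG ** U)"
      unfolding o'_def by (rule Cauchy_Schwarz_ineq2)
    moreover have "o' * norm (transpose SG ** U) \<le> o' * ((n + 1) * L * u)"
    proof (rule mult_left_mono[OF _ o0])
      have "norm (transpose SG ** U) \<le> norm SG * u"
        using norm_matrix_mult_le[of "transpose SG" U] by (simp add: u_def)
      also have "\<dots> \<le> (n + 1) * L * u" by (rule mult_right_mono[OF nSG u0])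
      finally show "norm (transpose SG ** U) \<le> (n + 1) * L * u" .
    qed
    ultimately show ?thesis by (simp add: mult_ac)
  qed
  have sq1: "(\<Sum>e\<in>?P. (norm (G e))\<^sup>2) \<le> (n + 1) * L\<^sup>2"
  proof -
    have "(\<Sum>e\<in>?P. (norm (G e))\<^sup>2) \<le> (\<Sum>e\<in>?P. (norm (Dt ** sel (\<Union>e)))\<^sup>2)"
      unfolding G_def by (intro sum_mono power_mono norm_block_proj_le[OF X]) simp
    also have "\<dots> = (n + 1) * (norm Dt)\<^sup>2" by (simp add: sum_norm_mult_sel l)
    also have "\<dots> \<le> (n + 1) * L\<^sup>2" using nDt n0 by (intro mult_left_mono power_mono) auto
    finally show ?thesis .
  qed
  have sq2: "(\<Sum>e\<in>?P. (x e)\<^sup>2) \<le> L\<^sup>2"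
  proof -
    have "norm (off_diag \<CC> A) \<le> L"
      using norm_off_diag_le[of \<CC> A] norm_transpose_mult_le[OF X, of Dt] nDt unfolding A_def by linarith
    then show ?thesis unfolding x_def sum_norm_off_diag_sel by (intro power_mono) auto
  qed
  define c where "c = 1 + n * (o' + 3 / 2 * u\<^sup>2 + 3 / 2 * \<gamma>\<^sup>2 * L\<^sup>2)"
  have c0: "0 \<le> c" using n0 o0 by (simp add: c_def)
  have "(\<Sum>e\<in>?P. metric_sq (Z e) (W - Z e)) \<le> (\<Sum>e\<in>?P. (n + 2) / 2 * ((u\<^sup>2 + n * o'\<^sup>2)
      + 2 * \<gamma> * (U \<bullet> G e + n * (Off \<bullet> (transpose X ** G e)))
      + 2 * \<gamma> * n * - (Off \<bullet> (transpose (G e) ** U))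
      + \<gamma>\<^sup>2 * c * (norm (G e))\<^sup>2 + 6 * n * \<gamma>\<^sup>2 * (x e)\<^sup>2))"
  proof (rule sum_mono)
    fix e assume "e \<in> ?P"
    from metric_sq_step_le[OF X W step[OF this] D \<gamma>(1)]
    show "metric_sq (Z e) (W - Z e) \<le> (n + 2) / 2 * ((u\<^sup>2 + n * o'\<^sup>2)
      + 2 * \<gamma> * (U \<bullet> G e + n * (Off \<bullet> (transpose X ** G e)))
      + 2 * \<gamma> * n * - (Off \<bullet> (transpose (G e) ** U))
      + \<gamma>\<^sup>2 * c * (norm (G e))\<^sup>2 + 6 * n * \<gamma>\<^sup>2 * (x e)\<^sup>2)"
      by (simp add: l U_def[symmetric] Dt_def[symmetric] A_def[symmetric] G_def[symmetric] Off_def[symmetric]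
          x_def[symmetric] u_def[symmetric] o'_def[symmetric] c_def mult_ac)
  qed
  also have "\<dots> = (n + 2) / 2 * (N * (u\<^sup>2 + n * o'\<^sup>2)
      + 2 * \<gamma> * (\<Sum>e\<in>?P. U \<bullet> G e + n * (Off \<bullet> (transpose X ** G e)))
      + 2 * \<gamma> * n * - (\<Sum>e\<in>?P. Off \<bullet> (transpose (G e) ** U))
      + \<gamma>\<^sup>2 * c * (\<Sum>e\<in>?P. (norm (G e))\<^sup>2) + 6 * n * \<gamma>\<^sup>2 * (\<Sum>e\<in>?P. (x e)\<^sup>2))"
    by (simp only: sum_distrib_left[symmetric] sum.distrib sum_negf[symmetric] sum_constant N_def)
      (simp add: algebra_simps)
  also have "\<dots> \<le> (n + 2) / 2 * (N * (u\<^sup>2 + n * o'\<^sup>2)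
      + 2 * \<gamma> * ((n + 1) * (D \<bullet> U + L / 2 * u\<^sup>2))
      + 2 * \<gamma> * n * ((n + 1) * L * u * o')
      + \<gamma>\<^sup>2 * c * ((n + 1) * L\<^sup>2) + 6 * n * \<gamma>\<^sup>2 * L\<^sup>2)"
    using n0 \<gamma> c0 lin1' unfolding lin1
    by (intro mult_left_mono add_mono lin2 sq1 sq2 order_refl) auto
  also have "\<dots> \<le> N * (metric_sq X U + 2 * \<gamma> * (D \<bullet> U) + g * u\<^sup>2 + 2 * n * g * u * o' + g\<^sup>2 * c + 6 * g\<^sup>2)"
  proof -
    \<comment> \<open>Since \<open>(n + 2) / 2\<close> times \<open>n + 1\<close> is
      \<open>N\<close>, terms with a factor \<open>n + 1\<close> become exact multiples of
      \<open>N\<close>. The term from \<open>x\<close> has only \<open>n\<close> and is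
      enlarged.\<close>
    have e1: "(n + 2) / 2 * (6 * n * \<gamma>\<^sup>2 * L\<^sup>2) \<le> N * (6 * g\<^sup>2)"
      unfolding N g_def using n0 by (simp add: power_mult_distrib mult_right_mono field_simps)
    have e2: "(n + 2) / 2 * (N * a + 2 * \<gamma> * ((n + 1) * b) + 2 * \<gamma> * n * ((n + 1) * L * u * o') + \<gamma>\<^sup>2 * c * ((n + 1) * L\<^sup>2) + d)
        = N * ((n + 2) / 2 * a + 2 * \<gamma> * b + 2 * \<gamma> * n * L * u * o' + \<gamma>\<^sup>2 * c * L\<^sup>2) + (n + 2) / 2 * d" for a b d
      unfolding N by (simp add: field_simps)
    have e3: "metric_sq X U + 2 * \<gamma> * (D \<bullet> U) + g * u\<^sup>2 + 2 * n * g * u * o' + g\<^sup>2 * c + 6 * g\<^sup>2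
        = ((n + 2) / 2 * (u\<^sup>2 + n * o'\<^sup>2) + 2 * \<gamma> * (D \<bullet> U + L / 2 * u\<^sup>2) + 2 * \<gamma> * n * L * u * o' + \<gamma>\<^sup>2 * c * L\<^sup>2) + 6 * g\<^sup>2"
      unfolding q g_def by (simp add: power_mult_distrib algebra_simps)
    have e4: "N * a + (n + 2) / 2 * (6 * n * \<gamma>\<^sup>2 * L\<^sup>2) \<le> N * (a + 6 * g\<^sup>2)" for a
      using e1 by (simp add: distrib_left)
    show ?thesis unfolding e2 e3 by (rule e4)
  qed
  also have "\<dots> \<le> N * (metric_sq X U + 2 * \<gamma> * (D \<bullet> U) + 2 * \<gamma> * (2 * real l - 3) * L * metric_sq X U / real l
      + 9 * \<gamma>\<^sup>2 * L\<^sup>2 + 4 * (real l - 2) * \<gamma> ^ 3 * L ^ 3 + (real l - 2) * \<gamma> ^ 4 * L ^ 4)"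
  proof (rule mult_left_mono)
    \<comment> \<open>The target admits \<open>2 n + 1\<close> copies of \<open>g u^2\<close>. The
      curvature term uses 1, this inequality \<open>n / 2\<close> and the term from \<open>Q\<close>
      uses \<open>3 n / 2\<close>, which exhausts it. Copies of \<open>n g o'^2\<close> number 2
      from here and 1 from \<open>t1\<close>.\<close>
    have bilin: "2 * n * g * u * o' \<le> n * g * (u\<^sup>2 / 2 + 2 * o'\<^sup>2)"
    proof -
      have "2 * (u * o') \<le> u\<^sup>2 / 2 + 2 * o'\<^sup>2"
        using sum_squares_ge_zero[of "u - 2 * o'" 0] by (simp add: power2_eq_square algebra_simps)
      from mult_left_mono[OF this, of "n * g"] show ?thesis using n0 g0 by (simp add: mult_ac)
    qed
    have t1: "g\<^sup>2 * o' \<le> g * o'\<^sup>2 + g ^ 3 / 4"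
    proof -
      have "g * o' \<le> o'\<^sup>2 + g\<^sup>2 / 4"
        using sum_squares_ge_zero[of "o' - g / 2" 0] by (simp add: power2_eq_square algebra_simps)
      from mult_left_mono[OF this g0] show ?thesis by (simp add: power2_eq_square power3_eq_cube algebra_simps)
    qed
    have gg: "g\<^sup>2 \<le> g" using g0 \<gamma>(2) by (simp add: g_def[symmetric] power2_eq_square mult_left_le)
    have t2: "g\<^sup>2 * u\<^sup>2 \<le> g * u\<^sup>2" by (rule mult_right_mono[OF gg]) simp
    have t3: "g ^ 4 \<le> g ^ 3"
      using power_decreasing[of 3 4 g] g0 \<gamma>(2) by (simp add: g_def)
    \<comment> \<open>Those three copies fit into \<open>2 n + 1\<close> because \<open>n\<close> is
      an integer: either \<open>n >= 1\<close>, or \<open>n = 0\<close> and the term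
      vanishes.\<close>
    have no: "n * (n * g * o'\<^sup>2) \<ge> n * g * o'\<^sup>2"
    proof -
      have "n \<ge> 1 \<or> n = 0" using two_le unfolding n_def by (cases "l = 2") auto
      moreover have "0 \<le> n * g * o'\<^sup>2" using n0 g0 by simp
      ultimately show ?thesis using mult_right_mono[of 1 n "n * g * o'\<^sup>2"] by auto
    qed
    have "g\<^sup>2 * c = g\<^sup>2 + n * (g\<^sup>2 * o') + n * (3 / 2 * (g\<^sup>2 * u\<^sup>2)) + n * (3 / 2 * g ^ 4)"
      by (simp add: c_def g_def power_mult_distrib algebra_simps power4_eq_xxxx power2_eq_square)
    also have "\<dots> \<le> g\<^sup>2 + n * (g * o'\<^sup>2 + g ^ 3 / 4) + n * (3 / 2 * (g * u\<^sup>2)) + n * (3 / 2 * g ^ 3)"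
      using t1 t2 t3 n0 by (intro add_mono mult_left_mono order_refl) auto
    finally have cc: "g\<^sup>2 * c \<le> g\<^sup>2 + n * (g * o'\<^sup>2 + g ^ 3 / 4) + n * (3 / 2 * (g * u\<^sup>2)) + n * (3 / 2 * g ^ 3)" .
    have "g * u\<^sup>2 + 2 * n * g * u * o' + g\<^sup>2 * c + 6 * g\<^sup>2
        \<le> g * u\<^sup>2 + n * g * (u\<^sup>2 / 2 + 2 * o'\<^sup>2) + (g\<^sup>2 + n * (g * o'\<^sup>2 + g ^ 3 / 4) + n * (3 / 2 * (g * u\<^sup>2)) + n * (3 / 2 * g ^ 3)) + 6 * g\<^sup>2"
      using bilin cc by linarith
    also have "\<dots> = g * u\<^sup>2 + 2 * (n * g * u\<^sup>2) + 3 * (n * g * o'\<^sup>2) + 7 * g\<^sup>2 + 7 / 4 * (n * g ^ 3)"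
      by (simp add: algebra_simps)
    also have "\<dots> \<le> g * u\<^sup>2 + 2 * (n * g * u\<^sup>2) + (2 * n + 1) * (n * g * o'\<^sup>2) + 9 * g\<^sup>2 + 4 * (n * g ^ 3) + n * g ^ 4"
    proof -
      have "0 \<le> n * g ^ 3" "0 \<le> n * g ^ 4" using n0 g0 by simp_all
      moreover have "0 \<le> g\<^sup>2" by simp
      moreover have "(2 * n + 1) * (n * g * o'\<^sup>2) = 2 * (n * (n * g * o'\<^sup>2)) + n * g * o'\<^sup>2"
        by (simp add: algebra_simps)
      ultimately show ?thesis using no by linarith
    qed
    also have "\<dots> = 2 * \<gamma> * (2 * real l - 3) * L * metric_sq X U / real l + 9 * \<gamma>\<^sup>2 * L\<^sup>2
        + 4 * (real l - 2) * \<gamma> ^ 3 * L ^ 3 + (real l - 2) * \<gamma> ^ 4 * L ^ 4"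
    proof -
      have "2 * \<gamma> * (2 * real l - 3) * L * metric_sq X U / real l = (2 * n + 1) * g * (u\<^sup>2 + n * o'\<^sup>2)"
        unfolding q l g_def using n0 by (simp add: field_simps)
      then show ?thesis by (simp add: l g_def power_mult_distrib algebra_simps)
    qed
    finally show "metric_sq X U + 2 * \<gamma> * (D \<bullet> U) + g * u\<^sup>2 + 2 * n * g * u * o' + g\<^sup>2 * c + 6 * g\<^sup>2
      \<le> metric_sq X U + 2 * \<gamma> * (D \<bullet> U) + 2 * \<gamma> * (2 * real l - 3) * L * metric_sq X U / real l
      + 9 * \<gamma>\<^sup>2 * L\<^sup>2 + 4 * (real l - 2) * \<gamma> ^ 3 * L ^ 3 + (real l - 2) * \<gamma> ^ 4 * L ^ 4" by linarith
  qed (simp add: N_def)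
  finally show ?thesis by (simp add: N_def)
qed

end

section \<open>Clarke subgradients and the envelope\<close>

lemma clarke_subdifferential_inner_le:
  assumes g: "g \<in> clarke_subdifferential f x"
    and ev: "\<forall>\<^sub>F p in nhds x \<times>\<^sub>F at_right 0. (f (fst p + snd p *\<^sub>R v) - f (fst p)) / snd p \<le> a"
  shows "g \<bullet> v \<le> a"
proof -
  have "clarke_derivative f x v \<le> ereal a"
    unfolding clarke_derivative_def
    by (rule Limsup_bounded) (use ev in \<open>simp add: case_prod_beta\<close>)
  moreover have "ereal (g \<bullet> v) \<le> clarke_derivative f x v"
    using g by (simp add: clarke_subdifferential_def)
  ultimately have "ereal (g \<bullet> v) \<le> ereal a" by (rule order_trans[rotated])
  then show ?thesis by simp
qed

text \<open>The base point of the Clarke quotient moves. \<open>s = 0\<close> keeps it near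
  \<open>x\<close>; \<open>s = 1\<close> with \<open>v = w - x\<close> keeps the shifted point near
  \<open>w\<close>.\<close>

lemma tendsto_difference_quotient_point:
  "((\<lambda>p. fst p + s *\<^sub>R v) \<longlongrightarrow> x + s *\<^sub>R v) (nhds x \<times>\<^sub>F at_right (0::real))"
  "((\<lambda>p. fst p + snd p *\<^sub>R v) \<longlongrightarrow> x) (nhds x \<times>\<^sub>F at_right (0::real))"
  for x :: "'a::real_normed_vector"
proof -
  have 1: "(fst \<longlongrightarrow> x) (nhds x \<times>\<^sub>F at_right (0::real))" by (rule filterlim_fst)
  have 2: "(snd \<longlongrightarrow> (0::real)) (nhds x \<times>\<^sub>F at_right (0::real))"
    by (rule filterlim_mono[OF filterlim_snd[of "at_right 0" "nhds x"] _ order_refl])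
       (simp add: at_within_le_nhds)
  show "((\<lambda>p. fst p + s *\<^sub>R v) \<longlongrightarrow> x + s *\<^sub>R v) (nhds x \<times>\<^sub>F at_right (0::real))"
    by (intro tendsto_intros 1)
  show "((\<lambda>p. fst p + snd p *\<^sub>R v) \<longlongrightarrow> x) (nhds x \<times>\<^sub>F at_right (0::real))"
    using tendsto_add[OF 1 tendsto_scaleR[OF 2 tendsto_const[of v]]] by simp
qed

lemma eventually_snd_at_right: 
  "\<forall>\<^sub>F p in nhds x \<times>\<^sub>F at_right (0::real). 0 < snd p \<and> snd p < 1"
proof -
  have "\<forall>\<^sub>F t in at_right (0::real). 0 < t \<and> t < 1"
    by (auto simp: eventually_at_right_field intro: exI[of _ 1])
  then show ?thesis by (rule eventually_compose_filterlim[OF _ filterlim_snd])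
qed

text \<open>Test the Clarke derivative in the direction \<open>g\<close> itself.\<close>

lemma norm_clarke_subdifferential_le:
  fixes f :: "'a::real_inner \<Rightarrow> real"
  assumes lip: "L-lipschitz_on \<Omega> f" and x: "x \<in> interior \<Omega>"
    and g: "g \<in> clarke_subdifferential f x"
  shows "norm g \<le> L"
proof -
  have "\<forall>\<^sub>F p in nhds x \<times>\<^sub>F at_right 0. (f (fst p + snd p *\<^sub>R g) - f (fst p)) / snd p \<le> L * norm g"
  proof -
    have "\<forall>\<^sub>F p in nhds x \<times>\<^sub>F at_right (0::real). fst p + 0 *\<^sub>R g \<in> interior \<Omega>"
      using x by (intro topological_tendstoD[OF tendsto_difference_quotient_point(1)]) auto
    moreover have "\<forall>\<^sub>F p in nhds x \<times>\<^sub>F at_right (0::real). fst p + snd p *\<^sub>R g \<in> interior \<Omega>"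
      using x by (intro topological_tendstoD[OF tendsto_difference_quotient_point(2)]) auto
    ultimately show ?thesis using eventually_snd_at_right[of x]
    proof eventually_elim
      case (elim p)
      then have "dist (f (fst p + snd p *\<^sub>R g)) (f (fst p)) \<le> L * dist (fst p + snd p *\<^sub>R g) (fst p)"
        using interior_subset by (intro lipschitz_onD[OF lip]) auto
      then have "f (fst p + snd p *\<^sub>R g) - f (fst p) \<le> L * norm g * snd p"
        using elim by (simp add: dist_norm mult_ac)
      then show ?case using elim by (simp add: pos_divide_le_eq)
    qed
  qed
  from clarke_subdifferential_inner_le[OF g this]
  have "norm g * norm g \<le> L * norm g" by (simp add: power2_norm_eq_inner flip: power2_eq_square)
  then show ?thesis using lipschitz_on_nonneg[OF lip] by (cases "g = 0") auto
qed

text \<open>For a base point \<open>y\<close> near \<open>x\<close>, weak convexity is applied on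
  the segment from \<open>y\<close> to \<open>y + v\<close>, a translate of the one from
  \<open>x\<close> to \<open>w\<close>. The Lipschitz property then moves both endpoints
  back.\<close>

lemma clarke_subgradient_ineq:
  fixes f :: "'a::real_inner \<Rightarrow> real"
  assumes lip: "L-lipschitz_on \<Omega> f" and \<Omega>: "convex \<Omega>"
    and cvx: "convex_on \<Omega> (\<lambda>y. f y + \<tau> / 2 * (norm y)\<^sup>2)" and \<tau>: "0 \<le> \<tau>"
    and x: "x \<in> interior \<Omega>" and w: "w \<in> interior \<Omega>"
    and g: "g \<in> clarke_subdifferential f x"
  shows "f x + g \<bullet> (w - x) - \<tau> / 2 * (norm (w - x))\<^sup>2 \<le> f w"
proof -
  define v where "v = w - x"
  have L: "0 \<le> L" by (rule lipschitz_on_nonneg[OF lip])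
  have "g \<bullet> v \<le> f w - f x + \<tau> / 2 * (norm v)\<^sup>2 + \<epsilon>" if "\<epsilon> > 0" for \<epsilon>
  proof (rule clarke_subdifferential_inner_le[OF g])
    \<comment> \<open>Two endpoints are displaced, each at cost \<open>L\<close> times the radius;
      the summand 1 keeps the denominator positive.\<close>
    define \<delta> where "\<delta> = \<epsilon> / (2 * L + 1)"
    have \<delta>: "\<delta> > 0" "2 * L * \<delta> \<le> \<epsilon>" using that L by (simp_all add: \<delta>_def field_simps)
    have "\<forall>\<^sub>F p in nhds x \<times>\<^sub>F at_right (0::real). fst p + 0 *\<^sub>R v \<in> interior \<Omega> \<inter> ball x \<delta>"
      using x \<delta> by (intro topological_tendstoD[OF tendsto_difference_quotient_point(1)]) auto
    moreover have "\<forall>\<^sub>F p in nhds x \<times>\<^sub>F at_right (0::real). fst p + 1 *\<^sub>R v \<in> interior \<Omega>"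
      using w by (intro topological_tendstoD[OF tendsto_difference_quotient_point(1)]) (auto simp: v_def)
    ultimately show "\<forall>\<^sub>F p in nhds x \<times>\<^sub>F at_right 0.
        (f (fst p + snd p *\<^sub>R v) - f (fst p)) / snd p \<le> f w - f x + \<tau> / 2 * (norm v)\<^sup>2 + \<epsilon>"
      using eventually_snd_at_right[of x]
    proof eventually_elim
      case (elim p)
      define y t where "y = fst p" and "t = snd p"
      have y: "y \<in> \<Omega>" "y + v \<in> \<Omega>" "dist x y < \<delta>" and t: "0 < t" "t < 1"
        using elim interior_subset by (auto simp: y_def t_def)
      have xw: "x \<in> \<Omega>" "w \<in> \<Omega>" using x w interior_subset by auto
      have "dist (f y) (f x) \<le> L * dist y x" "dist (f (y + v)) (f w) \<le> L * dist (y + v) w"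
        using y xw by (auto intro!: lipschitz_onD[OF lip])
      moreover have "dist (y + v) w = dist x y" "dist y x = dist x y"
        by (simp_all add: v_def dist_norm norm_minus_commute)
      moreover have "L * dist x y \<le> L * \<delta>" using y L by (intro mult_left_mono) auto
      ultimately have fv: "f (y + v) - f y \<le> f w - f x + \<epsilon>"
        using \<delta> by (simp add: dist_real_def)
      have "(1 - t) *\<^sub>R y + t *\<^sub>R (y + v) = y + t *\<^sub>R v" by (simp add: algebra_simps)
      then have c: "f (y + t *\<^sub>R v) + \<tau> / 2 * (norm (y + t *\<^sub>R v))\<^sup>2
          \<le> (1 - t) * (f y + \<tau> / 2 * (norm y)\<^sup>2) + t * (f (y + v) + \<tau> / 2 * (norm (y + v))\<^sup>2)"
        using convex_onD[OF cvx, of t y "y + v"] y t by simp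
      have e: "(norm (y + s *\<^sub>R v))\<^sup>2 = (norm y)\<^sup>2 + 2 * s * (y \<bullet> v) + s\<^sup>2 * (norm v)\<^sup>2" for s
        unfolding power2_norm_eq_inner by (simp add: inner_add_left inner_add_right inner_commute power2_eq_square algebra_simps)
      have "f (y + t *\<^sub>R v) - f y \<le> t * (f (y + v) - f y) + t * (\<tau> / 2 * (norm v)\<^sup>2) - t\<^sup>2 * (\<tau> / 2 * (norm v)\<^sup>2)"
        using c unfolding e[of t] e[of 1, simplified] by (simp add: field_simps)
      also have "\<dots> \<le> t * (f w - f x + \<epsilon>) + t * (\<tau> / 2 * (norm v)\<^sup>2)"
      proof -
        have "0 \<le> t\<^sup>2 * (\<tau> / 2 * (norm v)\<^sup>2)" using \<tau> by simp
        moreover have "t * (f (y + v) - f y) \<le> t * (f w - f x + \<epsilon>)"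
          using fv t by (intro mult_left_mono) auto
        ultimately show ?thesis by linarith
      qed
      finally have "f (y + t *\<^sub>R v) - f y \<le> (f w - f x + \<tau> / 2 * (norm v)\<^sup>2 + \<epsilon>) * t"
        by (simp add: algebra_simps)
      then show ?case
        unfolding y_def[symmetric] t_def[symmetric] by (simp only: pos_divide_le_eq[OF t(1)])
    qed
  qed
  then have "g \<bullet> v \<le> f w - f x + \<tau> / 2 * (norm v)\<^sup>2" by (rule field_le_epsilon)
  then show ?thesis by (simp add: v_def)
qed

text \<open>Makes sets described by the existence of a minimiser compact, hence Borel, without
  measurable selection.\<close>

lemma compact_projection:
  assumes "compact S" "compact T" "closed P"
  shows "compact {x \<in> S. \<exists>y\<in>T. (x, y) \<in> P}"
proof -
  have "{x \<in> S. \<exists>y\<in>T. (x, y) \<in> P} = fst ` ((S \<times> T) \<inter> P)" by force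
  then show ?thesis
    using assms by (simp only:) (intro compact_continuous_image continuous_intros compact_Int_closed compact_Times)
qed

section \<open>Proximal minimisers, the envelope and measurability\<close>

locale rssm_setting = column_partition \<CC> l
  for \<CC> :: "'p::finite set set" and l :: nat +
  fixes f :: "real ^ 'p ^ 'n \<Rightarrow> real" and \<Omega> :: "(real ^ 'p ^ 'n) set" and \<tau> L lam :: real
  assumes \<tau>_nonneg: "0 \<le> \<tau>" and L_pos: "0 < L" and lam_pos: "0 < lam"
    and convex_\<Omega>: "convex \<Omega>" and stiefel_\<Omega>: "stiefel \<subseteq> interior \<Omega>"
    and weakly_convex: "convex_on \<Omega> (\<lambda>Y. f Y + \<tau> / 2 * (norm Y)\<^sup>2)"
    and lipschitz: "L-lipschitz_on \<Omega> f"
begin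

definition objective :: "real ^ 'p ^ 'n \<Rightarrow> real ^ 'p ^ 'n \<Rightarrow> real"
  where "objective X Y = f Y + 1 / (2 * lam) * metric_sq X (Y - X)"

lemma prox_objective_eq: "X \<in> stiefel \<Longrightarrow> prox_objective f \<CC> lam X Y = objective X Y"
  by (simp add: prox_objective_def objective_def avg_inv_norm_sq)

lemma continuous_on_metric_sq [continuous_intros]:
  assumes "continuous_on S a" "continuous_on S b"
  shows "continuous_on S (\<lambda>x. metric_sq (a x :: real ^ 'p ^ 'n) (b x))"
  unfolding metric_sq_def by (intro continuous_intros matmul.continuous_on assms)

lemma continuous_on_f: "continuous_on stiefel f"
  using lipschitz_on_continuous_on[OF lipschitz] stiefel_\<Omega> interior_subset
  by (meson continuous_on_subset order_trans)

lemma continuous_on_objective [continuous_intros]: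
  assumes "continuous_on S a" "continuous_on S b" "b ` S \<subseteq> stiefel"
  shows "continuous_on S (\<lambda>x. objective (a x) (b x))"
  unfolding objective_def
  by (intro continuous_intros assms continuous_on_compose2[OF continuous_on_f assms(2,3)])

definition minimisers :: "real ^ 'p ^ 'n \<Rightarrow> (real ^ 'p ^ 'n) set"
  where "minimisers X = {W \<in> stiefel. \<forall>Y\<in>stiefel. objective X W \<le> objective X Y}"

lemma minimisers_nonempty:
  assumes "X \<in> stiefel" shows "minimisers X \<noteq> {}"
proof -
  have "\<exists>W\<in>stiefel. \<forall>Y\<in>stiefel. objective X W \<le> objective X Y"
    using assms by (intro continuous_attains_inf compact_stiefel continuous_intros) auto
  then show ?thesis by (auto simp: minimisers_def)
qed

lemma prox_in_minimisers:
  assumes "X \<in> stiefel" shows "prox f \<CC> lam X \<in> minimisers X"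
proof -
  obtain W where "W \<in> minimisers X" using minimisers_nonempty[OF assms] by blast
  moreover have "prox_objective f \<CC> lam X = objective X"
    by (rule ext) (rule prox_objective_eq[OF assms])
  ultimately show ?thesis
    unfolding prox_def arg_min_on_def
    by (simp only:) (rule arg_minI[where x = W], auto simp: minimisers_def not_less)
qed

lemma envelope_eq:
  assumes "X \<in> stiefel" "W \<in> minimisers X"
  shows "envelope f \<CC> lam X = objective X W"
  unfolding envelope_def using assms
  by (intro cInf_eq_minimum) (auto simp: minimisers_def prox_objective_eq)

lemma envelope_le:
  assumes "X \<in> stiefel" "Y \<in> stiefel" shows "envelope f \<CC> lam X \<le> objective X Y"
  using minimisers_nonempty[OF assms(1)] envelope_eq[OF assms(1)] assms(2)
  by (auto simp: minimisers_def)

text \<open>Attainment of the minimum turns a sublevel set of the envelope into a projection of a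
  closed set.\<close>

lemma envelope_le_iff:
  assumes "X \<in> stiefel"
  shows "envelope f \<CC> lam X \<le> c \<longleftrightarrow> (\<exists>W\<in>stiefel. objective X W \<le> c)"
  using minimisers_nonempty[OF assms] envelope_eq[OF assms] envelope_le[OF assms]
  by (auto simp: minimisers_def) (meson order_trans)

lemma closed_objective_le:
  assumes "continuous_on (stiefel \<times> stiefel) g"
  shows "closed {p \<in> stiefel \<times> (stiefel :: (real ^ 'p ^ 'n) set). g p \<le> (c::real)}"
proof -
  have "closed ((stiefel \<times> stiefel) \<inter> g -` {..c})"
    by (intro continuous_closed_preimage assms compact_imp_closed compact_Times compact_stiefel closed_atMost)
  also have "(stiefel \<times> stiefel) \<inter> g -` {..c} = {p \<in> stiefel \<times> stiefel. g p \<le> c}" by auto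
  finally show ?thesis .
qed

lemma envelope_measurable: "envelope f \<CC> lam \<in> borel_measurable (restrict_space borel stiefel)"
  unfolding borel_measurable_iff_le
proof
  fix c
  let ?P = "{p \<in> stiefel \<times> stiefel. objective (fst p) (snd p) \<le> c}"
  have "{X \<in> stiefel. envelope f \<CC> lam X \<le> c} = {X \<in> stiefel. \<exists>W\<in>stiefel. (X, W) \<in> ?P}"
    by (auto simp: envelope_le_iff)
  also have "compact \<dots>"
    by (intro compact_projection compact_stiefel closed_objective_le continuous_intros) auto
  finally show "{X \<in> space (restrict_space borel stiefel). envelope f \<CC> lam X \<le> c} \<in> sets (restrict_space borel stiefel)"
    by (auto simp: sets_restrict_space_iff space_restrict_space borel_compact compact_imp_closed compact_stiefel borel_closed)
qed

text \<open>
  The supremum over all minimisers makes measurability independent of the uniqueness of the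
  proximal point and of the choice made by \<^const>\<open>prox\<close>.
\<close>

definition worst_gap :: "real ^ 'p ^ 'n \<Rightarrow> real"
  where "worst_gap X = (SUP W\<in>minimisers X. metric_sq X (W - X))"

lemma bdd_above_gap:
  assumes "X \<in> stiefel" shows "bdd_above ((\<lambda>W. metric_sq X (W - X)) ` minimisers X)"
proof -
  have "compact ((\<lambda>W. metric_sq X (W - X)) ` stiefel)"
    by (intro compact_continuous_image compact_stiefel continuous_intros)
  then have "bdd_above ((\<lambda>W. metric_sq X (W - X)) ` stiefel)"
    by (intro bounded_imp_bdd_above compact_imp_bounded)
  then show ?thesis by (rule bdd_above_mono) (auto simp: minimisers_def)
qed

text \<open>A supremum exceeds \<open>c\<close> when some minimiser does. Splitting the strict
  inequality into thresholds \<open>c + 1 / (n + 1)\<close> exhibits the set as a countable union of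
  compact sets.\<close>

lemma worst_gap_measurable: "worst_gap \<in> borel_measurable (restrict_space borel stiefel)"
  unfolding borel_measurable_iff_greater
proof
  fix c
  let ?g = "\<lambda>X W. metric_sq X (W - X)"
  define S where "S n = {X \<in> stiefel. \<exists>W\<in>minimisers X. c + 1 / real (Suc n) \<le> ?g X W}" for n
  have "compact (S n)" for n
  proof -
    \<comment> \<open>Minimality of the second component is an intersection of closed conditions,
      one for each competitor \<open>Y\<close>.\<close>
    let ?P = "(\<Inter>Y\<in>stiefel. {p \<in> stiefel \<times> stiefel. objective (fst p) (snd p) - objective (fst p) Y \<le> 0})
      \<inter> {p \<in> stiefel \<times> stiefel. - ?g (fst p) (snd p) \<le> - (c + 1 / real (Suc n))}"
    have "S n = {X \<in> stiefel. \<exists>W\<in>stiefel. (X, W) \<in> ?P}"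
      by (auto simp: S_def minimisers_def)
    also have "compact \<dots>"
      by (intro compact_projection compact_stiefel closed_Int closed_INT ballI closed_objective_le continuous_intros) auto
    finally show ?thesis .
  qed
  then have "(\<Union>n. S n) \<in> sets borel" by (intro sets.countable_UN) (auto intro: borel_compact)
  moreover have "{X \<in> stiefel. c < worst_gap X} = (\<Union>n. S n)"
  proof -
    have a: "c < worst_gap X \<longleftrightarrow> (\<exists>W\<in>minimisers X. c < ?g X W)" if "X \<in> stiefel" for X
      unfolding worst_gap_def
      by (rule less_cSUP_iff[OF minimisers_nonempty[OF that] bdd_above_gap[OF that]])
    have b: "c < y \<longleftrightarrow> (\<exists>n. c + 1 / real (Suc n) \<le> y)" for y
    proof
      assume "c < y"
      then obtain n where "1 / real (Suc n) < y - c" using nat_approx_posE[of "y - c"] by auto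
      then show "\<exists>n. c + 1 / real (Suc n) \<le> y" by (intro exI[of _ n]) simp
    next
      assume "\<exists>n. c + 1 / real (Suc n) \<le> y"
      then obtain n where "c + 1 / real (Suc n) \<le> y" ..
      moreover have "0 < 1 / real (Suc n)" by simp
      ultimately show "c < y" by linarith
    qed
    have "{X \<in> stiefel. c < worst_gap X} = {X \<in> stiefel. \<exists>W\<in>minimisers X. c < ?g X W}"
      using a by blast
    also have "\<dots> = (\<Union>n. S n)" unfolding b S_def by blast
    finally show ?thesis .
  qed
  ultimately show "{X \<in> space (restrict_space borel stiefel). c < worst_gap X} \<in> sets (restrict_space borel stiefel)"
    by (auto simp: sets_restrict_space_iff space_restrict_space compact_imp_closed compact_stiefel borel_closed)
qed

lemma bounded_on_stiefel:
  "\<exists>B. \<forall>X\<in>stiefel. \<bar>envelope f \<CC> lam X\<bar> \<le> B \<and> \<bar>worst_gap X\<bar> \<le> B"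
proof -
  have "compact ((\<lambda>p. objective (fst p) (snd p)) ` (stiefel \<times> stiefel))"
    by (intro compact_continuous_image compact_Times compact_stiefel continuous_intros) auto
  then obtain B where B: "\<And>X Y. X \<in> stiefel \<Longrightarrow> Y \<in> stiefel \<Longrightarrow> \<bar>objective X Y\<bar> \<le> B"
    using compact_imp_bounded by (fastforce simp: bounded_iff)
  have "compact ((\<lambda>p. metric_sq (fst p) (snd p - fst p)) ` (stiefel \<times> (stiefel :: (real ^ 'p ^ 'n) set)))"
    by (intro compact_continuous_image compact_Times compact_stiefel continuous_intros)
  then obtain B' where B': "\<And>X Y :: real ^ 'p ^ 'n. X \<in> stiefel \<Longrightarrow> Y \<in> stiefel \<Longrightarrow> \<bar>metric_sq X (Y - X)\<bar> \<le> B'"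
    using compact_imp_bounded by (fastforce simp: bounded_iff)
  have "\<bar>envelope f \<CC> lam X\<bar> \<le> max B B' \<and> \<bar>worst_gap X\<bar> \<le> max B B'" if X: "X \<in> stiefel" for X
  proof -
    obtain W where W: "W \<in> minimisers X" using minimisers_nonempty[OF X] by blast
    then have Ws: "W \<in> stiefel" by (simp add: minimisers_def)
    have "metric_sq X (W - X) \<le> worst_gap X"
      unfolding worst_gap_def by (rule cSUP_upper[OF W bdd_above_gap[OF X]])
    then have "0 \<le> worst_gap X" using metric_sq_nonneg[of X "W - X"] by linarith
    moreover have "worst_gap X \<le> B'"
      unfolding worst_gap_def
      by (rule cSUP_least[OF minimisers_nonempty[OF X]]) (use B'[OF X] in \<open>force simp: minimisers_def\<close>)
    ultimately show ?thesis using B[OF X Ws] envelope_eq[OF X W] by auto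
  qed
  then show ?thesis by blast
qed

section \<open>Mean descent of the envelope\<close>

definition descent_error :: "real \<Rightarrow> real"
  where "descent_error \<gamma> = 9 * \<gamma>\<^sup>2 * L\<^sup>2 / (2 * lam) + 2 * (real l - 2) * \<gamma> ^ 3 * L ^ 3 / lam
    + (real l - 2) * \<gamma> ^ 4 * L ^ 4 / (2 * lam)"

definition descent_rate :: real
  where "descent_rate = lam / real l * (real l / (2 * lam) - (\<tau> + (2 * real l - 3) * L))"

lemma descent:
  assumes X: "X \<in> stiefel" and D: "D \<in> clarke_subdifferential f X"
    and step: "\<And>e. e \<in> block_pairs \<CC> \<Longrightarrow> rssm_step \<gamma> e D X (Z e)"
    and \<gamma>: "0 \<le> \<gamma>" "\<gamma> * L \<le> 1" and W: "W \<in> minimisers X"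
  shows "(\<Sum>e\<in>block_pairs \<CC>. envelope f \<CC> lam (Z e)) / real (card (block_pairs \<CC>))
    \<le> envelope f \<CC> lam X + descent_error \<gamma> - \<gamma> / lam\<^sup>2 * metric_sq X (W - X) * descent_rate"
proof -
  let ?P = "block_pairs \<CC>"
  define N q where "N = real (card ?P)" and "q = metric_sq X (W - X)"
  have N: "N > 0" using card_pairs_pos by (simp add: N_def)
  have l: "real l > 0" using two_le by simp
  have Ws: "W \<in> stiefel" using W by (simp add: minimisers_def)
  have Xi: "X \<in> interior \<Omega>" "W \<in> interior \<Omega>" using X Ws stiefel_\<Omega> by auto
  have nD: "norm D \<le> L" by (rule norm_clarke_subdifferential_le[OF lipschitz Xi(1) D])
  define E where "E = 2 * \<gamma> * (2 * real l - 3) * L * q / real l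
      + 9 * \<gamma>\<^sup>2 * L\<^sup>2 + 4 * (real l - 2) * \<gamma> ^ 3 * L ^ 3 + (real l - 2) * \<gamma> ^ 4 * L ^ 4"
  have S: "(\<Sum>e\<in>?P. metric_sq (Z e) (W - Z e)) \<le> N * (q + 2 * \<gamma> * (D \<bullet> (W - X)) + E)"
    using sum_metric_sq_step_le[OF X Ws nD step \<gamma>] by (simp add: N_def q_def E_def add_ac)
  \<comment> \<open>\<open>X\<close> itself competes in the minimisation, at metric cost
    zero.\<close>
  have fW: "f W + q / (2 * lam) \<le> f X"
    using W X by (auto simp: minimisers_def objective_def q_def metric_sq_def linear_0[OF linear_off_diag] dest: bspec[of _ _ X])
  have env: "envelope f \<CC> lam X = f W + q / (2 * lam)"
    by (simp add: envelope_eq[OF X W] objective_def q_def)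
  have "(norm (W - X))\<^sup>2 \<le> 2 / real l * q"
  proof -
    have "0 \<le> (real l - 2) * (norm (off_diag \<CC> (transpose X ** (W - X))))\<^sup>2" using two_le by simp
    then show ?thesis using l by (simp add: q_def metric_sq_def)
  qed
  then have "\<tau> / 2 * (norm (W - X))\<^sup>2 \<le> \<tau> / 2 * (2 / real l * q)"
    using \<tau>_nonneg by (intro mult_left_mono) auto
  also have "\<dots> = \<tau> * q / real l" by simp
  finally have weak: "\<tau> / 2 * (norm (W - X))\<^sup>2 \<le> \<tau> * q / real l" .
  \<comment> \<open>The subgradient inequality bounds the inner product by \<open>f W - f X\<close>
    plus the weak convexity error; minimality makes \<open>f W - f X\<close> at most
    \<open>- q / (2 lam)\<close>.\<close>
  then have DU: "D \<bullet> (W - X) \<le> - q / (2 * lam) + \<tau> * q / real l"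
    using clarke_subgradient_ineq[OF lipschitz convex_\<Omega> weakly_convex \<tau>_nonneg Xi D] fW weak
    unfolding minus_divide_left[symmetric] by linarith
  have "(\<Sum>e\<in>?P. envelope f \<CC> lam (Z e)) \<le> (\<Sum>e\<in>?P. objective (Z e) W)"
  proof (intro sum_mono envelope_le Ws)
    fix e assume "e \<in> ?P"
    then show "Z e \<in> stiefel"
      using rssm_step_strong_proj(1)[OF X step] by (simp add: strong_proj_def)
  qed
  also have "\<dots> = N * f W + 1 / (2 * lam) * (\<Sum>e\<in>?P. metric_sq (Z e) (W - Z e))"
    by (simp add: objective_def sum.distrib N_def flip: sum_divide_distrib)
  also have "\<dots> \<le> N * f W + 1 / (2 * lam) * (N * (q + 2 * \<gamma> * (D \<bullet> (W - X)) + E))"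
    using S lam_pos by (intro add_left_mono mult_left_mono) auto
  also have "\<dots> = N * (f W + 1 / (2 * lam) * (q + 2 * \<gamma> * (D \<bullet> (W - X)) + E))"
    by (simp add: algebra_simps)
  finally have "(\<Sum>e\<in>?P. envelope f \<CC> lam (Z e)) / N \<le> f W + 1 / (2 * lam) * (q + 2 * \<gamma> * (D \<bullet> (W - X)) + E)"
    using N by (simp add: pos_divide_le_eq mult.commute)
  also have "\<dots> \<le> f W + 1 / (2 * lam) * (q + 2 * \<gamma> * (- q / (2 * lam) + \<tau> * q / real l) + E)"
    using DU \<gamma> lam_pos by (intro add_mono order_refl mult_left_mono) auto
  \<comment> \<open>The coefficients of \<open>q\<close> linear in the stepsize collect to
    \<open>- (1/2 - lam (\<tau> + (2 l - 3) L) / l)\<close> times the stepsize over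
    \<open>lam^2\<close>, and the bracket is \<open>descent_rate\<close>.\<close>
  also have "\<dots> = envelope f \<CC> lam X + descent_error \<gamma> - \<gamma> / lam\<^sup>2 * q * descent_rate"
    unfolding env descent_error_def descent_rate_def E_def using lam_pos l
    by (simp add: field_simps power2_eq_square)
  finally show ?thesis by (simp add: N_def q_def)
qed

end

section \<open>Conditional expectation of the envelope\<close>

text \<open>Split \<open>Y\<close> over the values of the draw. Each \<open>g e\<close> is known
  given \<open>F\<close> and factors out, and independence turns the indicator of the draw into its
  probability.\<close>

lemma real_cond_exp_uniform_draw:
  fixes g :: "'e \<Rightarrow> 'w \<Rightarrow> real"
  assumes M: "prob_space M" and F: "subalgebra M F"
    and A: "finite A" and E: "E \<in> measurable M (count_space A)"
    and unif: "distr M (count_space A) E = uniform_count_measure A"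
    and indep: "prob_space.indep_set M (sets (vimage_algebra (space M) E (count_space A))) (sets F)"
    and g: "\<And>e. g e \<in> borel_measurable F" and B: "\<And>e \<omega>. \<omega> \<in> space M \<Longrightarrow> \<bar>g e \<omega>\<bar> \<le> B"
    and Y: "Y \<in> borel_measurable M" "\<And>\<omega>. \<omega> \<in> space M \<Longrightarrow> Y \<omega> = g (E \<omega>) \<omega>"
  shows "AE \<omega> in M. real_cond_exp M F Y \<omega> = (\<Sum>e\<in>A. g e \<omega>) / real (card A)"
proof -
  interpret prob_space M by fact
  interpret sub: finite_measure_subalgebra M F by unfold_locales (rule F)
  define P where "P e = E -` {e} \<inter> space M" for e
  \<comment> \<open>Stated for all \<open>e\<close>, because the sum rule for conditional
    expectations asks integrability for every index; outside \<open>A\<close> the event is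
    empty.\<close>
  have P: "P e \<in> sets M" for e
  proof (cases "e \<in> A")
    case True
    then show ?thesis unfolding P_def by (intro measurable_sets[OF E]) auto
  next
    case False
    then have "P e = {}" using measurable_space[OF E] by (auto simp: P_def)
    then show ?thesis by simp
  qed
  have gM: "g e \<in> borel_measurable M" for e by (rule measurable_from_subalg[OF F g])
  have ind: "AE \<omega> in M. real_cond_exp M F (indicator (P e)) \<omega> = 1 / real (card A)" if e: "e \<in> A" for e
  proof (rule sub.real_cond_exp_charact)
    have "measure M (P e) = measure (distr M (count_space A) E) {e}"
      unfolding P_def using e by (intro measure_distr[OF E, symmetric]) auto
    also have "\<dots> = 1 / real (card A)"
      using A e by (simp add: unif measure_uniform_count_measure)
    finally have pe: "measure M (P e) = 1 / real (card A)" .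
    fix S assume S: "S \<in> sets F"
    then have SM: "S \<in> sets M" using F by (auto simp: subalgebra_def)
    have "P e \<in> sets (vimage_algebra (space M) E (count_space A))"
      unfolding P_def using e by (intro in_vimage_algebra) auto
    then have "prob (P e \<inter> S) = prob (P e) * prob S"
      by (intro indep_setD[OF indep] S)
    then show "(\<integral>x\<in>S. indicator (P e) x \<partial>M) = (\<integral>x\<in>S. 1 / real (card A) \<partial>M)"
      using SM P[of e] pe
      by (simp add: set_lebesgue_integral_def indicator_inter_arith[symmetric] Int_commute)
  next
    show "integrable M (indicator (P e) :: 'w \<Rightarrow> real)"
      by (intro integrable_real_indicator P) (simp add: emeasure_eq_measure)
  qed simp_all
  have int: "integrable M (\<lambda>\<omega>. g e \<omega> * indicator (P e) \<omega>)" for e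
  proof (rule integrable_const_bound[of _ "\<bar>B\<bar>"])
    show "AE \<omega> in M. norm (g e \<omega> * indicator (P e) \<omega>) \<le> \<bar>B\<bar>"
      using B[of _ e] by (intro AE_I2) (fastforce simp: indicator_def)
    show "(\<lambda>\<omega>. g e \<omega> * indicator (P e) \<omega>) \<in> borel_measurable M"
      using P gM by measurable
  qed
  have Ysum: "Y \<omega> = (\<Sum>e\<in>A. g e \<omega> * indicator (P e) \<omega>)" if "\<omega> \<in> space M" for \<omega>
  proof -
    have "E \<omega> \<in> A" using measurable_space[OF E that] by simp
    moreover have "(\<Sum>e\<in>A. g e \<omega> * indicator (P e) \<omega>) = (\<Sum>e\<in>A. if e = E \<omega> then g e \<omega> else 0)"
      using that by (intro sum.cong) (auto simp: P_def indicator_def)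
    ultimately show ?thesis using Y(2)[OF that] A by simp
  qed
  have "AE \<omega> in M. real_cond_exp M F Y \<omega> = real_cond_exp M F (\<lambda>\<omega>. \<Sum>e\<in>A. g e \<omega> * indicator (P e) \<omega>) \<omega>"
    using Ysum Y(1) int by (intro sub.real_cond_exp_cong AE_I2) (auto intro!: borel_measurable_sum dest: borel_measurable_integrable)
  moreover have "AE \<omega> in M. real_cond_exp M F (\<lambda>\<omega>. \<Sum>e\<in>A. g e \<omega> * indicator (P e) \<omega>) \<omega>
      = (\<Sum>e\<in>A. real_cond_exp M F (\<lambda>\<omega>. g e \<omega> * indicator (P e) \<omega>) \<omega>)"
    by (rule sub.real_cond_exp_sum[OF int])
  moreover have "AE \<omega> in M. \<forall>e\<in>A. real_cond_exp M F (\<lambda>\<omega>. g e \<omega> * indicator (P e) \<omega>) \<omega> = g e \<omega> / real (card A)"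
  proof (rule AE_finite_allI[OF A])
    fix e assume "e \<in> A"
    have "AE \<omega> in M. real_cond_exp M F (\<lambda>\<omega>. g e \<omega> * indicator (P e) \<omega>) \<omega> = g e \<omega> * real_cond_exp M F (indicator (P e)) \<omega>"
      using P by (intro sub.real_cond_exp_mult g int) auto
    then show "AE \<omega> in M. real_cond_exp M F (\<lambda>\<omega>. g e \<omega> * indicator (P e) \<omega>) \<omega> = g e \<omega> / real (card A)"
      using ind[OF \<open>e \<in> A\<close>] by eventually_elim simp
  qed
  ultimately show ?thesis
    by eventually_elim (simp add: sum_divide_distrib)
qed

text \<open>The step as a function, so that at a given outcome the successors for all pairs exist,
  not only the one that was drawn.\<close>

definition rssm_next :: "real \<Rightarrow> 'p set set \<Rightarrow> real ^ 'p ^ 'n \<Rightarrow> real ^ 'p ^ 'n \<Rightarrow> real ^ 'p ^ 'n"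
  where "rssm_next \<gamma> e D X =
    closest_point (block_manifold X (\<Union>e)) (cols X (\<Union>e) - \<gamma> *\<^sub>R closest_point (block_tangent X (\<Union>e)) (D ** sel (\<Union>e)))
    + cols X (- \<Union>e)"

lemma rssm_step_unique: "rssm_step \<gamma> e D X X' \<Longrightarrow> X' = rssm_next \<gamma> e D X"
  using cols_split[of X' "\<Union>e"] by (simp add: rssm_step_def rssm_next_def Let_def)

lemma rssm_step_next:
  assumes "X \<in> stiefel" shows "rssm_step \<gamma> e D X (rssm_next \<gamma> e D X)"
proof -
  let ?C = "\<Union>e"
  define Z where "Z = closest_point (block_manifold X ?C) (cols X ?C - \<gamma> *\<^sub>R closest_point (block_tangent X ?C) (D ** sel ?C))"
  have "block_manifold X ?C \<noteq> {}" using cols_in_block_manifold[OF assms] by blast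
  then have "Z \<in> block_manifold X ?C"
    unfolding Z_def by (rule closest_point_in_set[OF closed_block_manifold])
  then have Z: "Z ** sel ?C = Z" by (simp add: block_manifold_def stiefel_on_def cols_def)
  have "Z ** sel (- ?C) = 0" by (subst Z[symmetric]) simp
  then show ?thesis
    by (simp add: rssm_step_def rssm_next_def Let_def Z_def[symmetric]) (simp add: cols_def mat_distrib Z)
qed

lemma rssm_next_in_stiefel: "X \<in> stiefel \<Longrightarrow> rssm_next \<gamma> e D X \<in> stiefel"
  using rssm_step_strong_proj(1)[OF _ rssm_step_next] by (auto simp: strong_proj_def)

text \<open>Nearest points on a nonconvex set need not vary continuously. Here all successors are
  strong projections of trial points, so nonexpansiveness passes the continuity of the trial point
  on to them.\<close>

lemma continuous_on_rssm_next:
  "continuous_on (stiefel \<times> UNIV) (\<lambda>p. rssm_next \<gamma> e (snd p) (fst p :: real ^ 'p ^ 'n))"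
proof -
  define Y where "Y p = fst p - \<gamma> *\<^sub>R block_proj (fst p) (\<Union>e) (tangent_grad (fst p) (snd p))"
    for p :: "(real ^ 'p ^ 'n) \<times> (real ^ 'p ^ 'n)"
  have "continuous_on (stiefel \<times> UNIV) Y"
    unfolding Y_def block_proj_eq tangent_grad_def sym_part_def
    by (intro continuous_intros matmul.continuous_on)
  moreover have "dist (rssm_next \<gamma> e (snd p) (fst p)) (rssm_next \<gamma> e (snd q) (fst q)) \<le> dist (Y p) (Y q)"
    if "p \<in> stiefel \<times> UNIV" "q \<in> stiefel \<times> UNIV" for p q
  proof -
    have "strong_proj (Y r) (rssm_next \<gamma> e (snd r) (fst r))" if "r \<in> stiefel \<times> UNIV" for r
      using that rssm_step_strong_proj(1)[OF _ rssm_step_next] unfolding Y_def by auto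
    then show ?thesis
      unfolding dist_norm using that by (intro strong_proj_nonexpansive)
  qed
  ultimately show ?thesis
    unfolding continuous_on_iff by (meson order_le_less_trans)
qed

lemma rssm_run_in_stiefel:
  assumes run: "rssm_run M \<F> f \<CC> \<gamma> X0 X D E" and init: "X0 \<in> stiefel" and "\<omega> \<in> space M"
  shows "X k \<omega> \<in> stiefel"
proof (induction k)
  case 0
  then show ?case using assms by (simp add: rssm_run_def)
next
  case (Suc k)
  have "rssm_step (\<gamma> k) (E k \<omega>) (D k \<omega>) (X k \<omega>) (X (Suc k) \<omega>)"
    using assms by (auto simp: rssm_run_def)
  then show ?case using rssm_step_strong_proj(1)[OF Suc] by (simp add: strong_proj_def)
qed

section \<open>Conditioning on the current iterate\<close>

context rssm_setting
begin

lemma cond_exp_descent: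
  fixes M :: "'w measure"
  assumes run: "rssm_run M \<F> f \<CC> \<gamma> X0 X D E" and init: "X0 \<in> stiefel"
    and \<gamma>: "0 < \<gamma> k" "\<gamma> k * L \<le> 1" and rate: "0 < descent_rate"
  shows "AE \<omega> in M. real_cond_exp M (vimage_algebra (space M) (X k) borel) (\<lambda>\<omega>'. envelope f \<CC> lam (X (Suc k) \<omega>')) \<omega>
    \<le> envelope f \<CC> lam (X k \<omega>) + descent_error (\<gamma> k) - \<gamma> k / lam\<^sup>2 * worst_gap (X k \<omega>) * descent_rate"
proof -
  let ?env = "envelope f \<CC> lam" and ?P = "block_pairs \<CC>"
  let ?S = "vimage_algebra (space M) (X k) borel"
  let ?Y = "\<lambda>\<omega>'. ?env (X (Suc k) \<omega>')"
  have M: "prob_space M" and filt: "filtration (space M) \<F>" and F: "\<And>k. subalgebra M (\<F> k)"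
    and X: "\<And>k. X k \<in> borel_measurable (\<F> k)" and D: "\<And>k. D k \<in> borel_measurable (\<F> k)"
    and E: "E k \<in> measurable (\<F> (Suc k)) (count_space ?P)"
    and unif: "distr M (count_space ?P) (E k) = uniform_count_measure ?P"
    and indep: "prob_space.indep_set M (sets (vimage_algebra (space M) (E k) (count_space ?P))) (sets (\<F> k))"
    and sub: "\<And>\<omega>. \<omega> \<in> space M \<Longrightarrow> D k \<omega> \<in> clarke_subdifferential f (X k \<omega>)"
    and step: "\<And>\<omega>. \<omega> \<in> space M \<Longrightarrow> rssm_step (\<gamma> k) (E k \<omega>) (D k \<omega>) (X k \<omega>) (X (Suc k) \<omega>)"
    using run by (auto simp: rssm_run_def)
  note X_st = rssm_run_in_stiefel[OF run init]
  interpret prob_space M by fact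
  have spF: "space (\<F> j) = space M" for j using F by (simp add: subalgebra_def)
  have XM: "X j \<in> borel_measurable M" for j by (rule measurable_from_subalg[OF F X])
  have S_F: "subalgebra (\<F> k) ?S"
    unfolding subalgebra_def
  proof
    show "sets ?S \<subseteq> sets (\<F> k)"
      using measurable_sets[OF X[of k]] by (auto simp: sets_vimage_algebra2 spF)
  qed (simp add: spF)
  have S_M: "subalgebra M ?S" using S_F F[of k] by (auto simp: subalgebra_def)
  interpret S: finite_measure_subalgebra M ?S by unfold_locales (rule S_M)
  interpret Fk: finite_measure_subalgebra M "\<F> k" by unfold_locales (rule F)

  obtain B where B: "\<And>X. X \<in> stiefel \<Longrightarrow> \<bar>?env X\<bar> \<le> B" "\<And>X. X \<in> stiefel \<Longrightarrow> \<bar>worst_gap X\<bar> \<le> B"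
    using bounded_on_stiefel by blast
  have st: "X j \<in> measurable N (restrict_space borel stiefel)" if "X j \<in> borel_measurable N" "space N = space M" for j N
    using that X_st by (intro measurable_restrict_space2) auto
  have XS: "X k \<in> borel_measurable ?S" by (rule measurable_vimage_algebra1) simp
  have Ymeas: "?Y \<in> borel_measurable M"
    by (rule measurable_compose[OF st[OF XM refl] envelope_measurable])
  have Yint: "integrable M ?Y"
    using B X_st by (intro integrable_const_bound[of _ B] AE_I2 Ymeas) auto

  \<comment> \<open>The envelope at the hypothetical successor for pair \<open>e\<close>; it does
    not involve the draw, so it is measurable before it.\<close>
  define g where "g e \<omega> = ?env (rssm_next (\<gamma> k) e (D k \<omega>) (X k \<omega>))" for e \<omega>
  have gF: "g e \<in> borel_measurable (\<F> k)" for e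
  proof -
    have "(\<lambda>\<omega>. (X k \<omega>, D k \<omega>)) \<in> measurable (\<F> k) (restrict_space borel (stiefel \<times> UNIV))"
      using X_st borel_measurable_Pair[OF X[of k] D[of k]] by (intro measurable_restrict_space2) (auto simp: spF)
    from measurable_compose[OF this borel_measurable_continuous_on_restrict[OF continuous_on_rssm_next]]
    have "(\<lambda>\<omega>. rssm_next (\<gamma> k) e (D k \<omega>) (X k \<omega>)) \<in> borel_measurable (\<F> k)" by simp
    then have "(\<lambda>\<omega>. rssm_next (\<gamma> k) e (D k \<omega>) (X k \<omega>)) \<in> measurable (\<F> k) (restrict_space borel stiefel)"
      using X_st by (intro measurable_restrict_space2) (auto simp: spF rssm_next_in_stiefel)
    from measurable_compose[OF this envelope_measurable] show ?thesis by (simp add: g_def[abs_def])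
  qed
  define H where "H \<omega> = (\<Sum>e\<in>?P. g e \<omega>) / real (card ?P)" for \<omega>
  have H: "AE \<omega> in M. real_cond_exp M (\<F> k) ?Y \<omega> = H \<omega>"
    unfolding H_def
  proof (rule real_cond_exp_uniform_draw[OF M F finite_pairs _ unif indep gF _ Ymeas])
    show "E k \<in> measurable M (count_space ?P)" by (rule measurable_from_subalg[OF F E])
    show "\<bar>g e \<omega>\<bar> \<le> B" if "\<omega> \<in> space M" for e \<omega>
      unfolding g_def using X_st[OF that] by (intro B rssm_next_in_stiefel)
    show "?env (X (Suc k) \<omega>) = g (E k \<omega>) \<omega>" if "\<omega> \<in> space M" for \<omega>
      unfolding g_def using rssm_step_unique[OF step[OF that]] by simp
  qed

  define h where "h \<omega> = ?env (X k \<omega>) + descent_error (\<gamma> k) - \<gamma> k / lam\<^sup>2 * worst_gap (X k \<omega>) * descent_rate" for \<omega>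
  have hS: "h \<in> borel_measurable ?S"
  proof -
    have "(\<lambda>\<omega>. ?env (X k \<omega>)) \<in> borel_measurable ?S" "(\<lambda>\<omega>. worst_gap (X k \<omega>)) \<in> borel_measurable ?S"
      by (rule measurable_compose[OF st[OF XS]], simp, rule envelope_measurable worst_gap_measurable)+
    then show ?thesis unfolding h_def[abs_def] by measurable
  qed
  have "integrable M (\<lambda>\<omega>. ?env (X k \<omega>))" "integrable M (\<lambda>\<omega>. worst_gap (X k \<omega>))"
    using B X_st measurable_compose[OF st[OF XM refl] envelope_measurable]
      measurable_compose[OF st[OF XM refl] worst_gap_measurable]
    by (auto intro!: integrable_const_bound[of _ B] AE_I2)
  then have hint: "integrable M h" unfolding h_def[abs_def] by simp
  have Hh: "H \<omega> \<le> h \<omega>" if \<omega>: "\<omega> \<in> space M" for \<omega>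
  proof -
    have Xk: "X k \<omega> \<in> stiefel" by (rule X_st[OF \<omega>])
    \<comment> \<open>The descent bound holds for each minimiser separately. Dividing by the
      positive \<open>c\<close> allows passing to the supremum \<open>worst_gap\<close>.\<close>
    define c where "c = \<gamma> k / lam\<^sup>2 * descent_rate"
    have c: "c > 0" using \<gamma> rate lam_pos by (simp add: c_def)
    have "c * metric_sq (X k \<omega>) (W - X k \<omega>) \<le> ?env (X k \<omega>) + descent_error (\<gamma> k) - H \<omega>"
      if "W \<in> minimisers (X k \<omega>)" for W
      using descent[OF Xk sub[OF \<omega>] rssm_step_next[OF Xk] less_imp_le[OF \<gamma>(1)] \<gamma>(2) that]
      by (simp add: H_def g_def c_def mult_ac)
    then have "worst_gap (X k \<omega>) \<le> (?env (X k \<omega>) + descent_error (\<gamma> k) - H \<omega>) / c"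
      unfolding worst_gap_def using c
      by (intro cSUP_least minimisers_nonempty[OF Xk]) (simp add: pos_le_divide_eq mult.commute)
    then show ?thesis using c by (simp add: h_def c_def[symmetric] pos_le_divide_eq mult_ac) (simp add: c_def mult_ac)
  qed
  \<comment> \<open>\<open>H\<close> may depend on the selected subgradient, \<open>h\<close> only
    on \<open>X k\<close>. Conditioning down leaves \<open>h\<close> unchanged, and the tower
    property identifies the left side.\<close>
  have "AE \<omega> in M. real_cond_exp M ?S (real_cond_exp M (\<F> k) ?Y) \<omega> \<le> real_cond_exp M ?S h \<omega>"
    using H Hh by (intro S.real_cond_exp_mono hint Fk.real_cond_exp_int Yint) (auto elim!: AE_mp)
  moreover have "AE \<omega> in M. real_cond_exp M ?S (real_cond_exp M (\<F> k) ?Y) \<omega> = real_cond_exp M ?S ?Y \<omega>"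
    by (rule S.real_cond_exp_nested_subalg[OF F S_F Yint])
  moreover have "AE \<omega> in M. real_cond_exp M ?S h \<omega> = h \<omega>"
    by (rule S.real_cond_exp_F_meas[OF hint hS])
  ultimately show ?thesis by eventually_elim (simp add: h_def)
qed

end

theorem proposition4p8:
  fixes f :: "real ^ 'p ^ 'n \<Rightarrow> real"
    and \<Omega> :: "(real ^ 'p ^ 'n) set"
    and \<tau> L lam :: real
    and \<CC> :: "'p set set"
    and l k :: nat
    and \<gamma> :: "nat \<Rightarrow> real"
    and X0 :: "real ^ 'p ^ 'n"
    and M :: "'w measure"
    and \<F> :: "nat \<Rightarrow> 'w measure"
    and X D :: "nat \<Rightarrow> 'w \<Rightarrow> real ^ 'p ^ 'n"
    and E :: "nat \<Rightarrow> 'w \<Rightarrow> 'p set set"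
  assumes dim: "CARD('p) \<le> CARD('n)"
    and partition: "partition_on UNIV \<CC>" "card \<CC> = l" "l \<ge> 2"
    and constants: "\<tau> \<ge> 0" "L > 0"
    and neighborhood: "bounded \<Omega>" "convex \<Omega>" "stiefel \<subseteq> interior \<Omega>"
    and weakly_convex: "convex_on \<Omega> (\<lambda>Y. f Y + \<tau> / 2 * (norm Y)\<^sup>2)"
    and Lipschitz: "L-lipschitz_on \<Omega> f"
    and init: "X0 \<in> stiefel"
    and stepsizes: "\<And>i. \<gamma> i \<in> {0<..<1 / L}"
    and run: "rssm_run M \<F> f \<CC> \<gamma> X0 X D E"
    and lambda: "lam \<in> {0<..<real l / (2 * (\<tau> + (2 * real l - 1) * L))}"
  shows "AE \<omega> in M.
     \<gamma> k * (stationarity_measure f \<CC> lam (X k \<omega>))\<^sup>2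
       = \<gamma> k / lam\<^sup>2 * (avg_inv_norm \<CC> (X k \<omega>) (prox f \<CC> lam (X k \<omega>) - X k \<omega>))\<^sup>2
   \<and> \<gamma> k / lam\<^sup>2 * (avg_inv_norm \<CC> (X k \<omega>) (prox f \<CC> lam (X k \<omega>) - X k \<omega>))\<^sup>2
       \<le> (envelope f \<CC> lam (X k \<omega>)
            - real_cond_exp M (vimage_algebra (space M) (X k) borel)
                (\<lambda>\<omega>'. envelope f \<CC> lam (X (Suc k) \<omega>')) \<omega>
            + 9 * (\<gamma> k)\<^sup>2 * L\<^sup>2 / (2 * lam)
            + 2 * (real l - 2) * (\<gamma> k) ^ 3 * L ^ 3 / lam
            + (real l - 2) * (\<gamma> k) ^ 4 * L ^ 4 / (2 * lam))
         / (lam / real l * (real l / (2 * lam) - (\<tau> + (2 * real l - 3) * L)))"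
proof -
  have lam: "0 < lam" using lambda by simp
  interpret rssm: rssm_setting \<CC> l f \<Omega> \<tau> L lam
    using partition constants neighborhood weakly_convex Lipschitz lam by unfold_locales auto
  define r where "r = rssm.descent_rate"
  have l: "real l \<ge> 2" using partition(3) by simp
  have r: "0 < r"
  proof -
    have "0 < (2 * real l - 1) * L" using l constants by simp
    then have "0 < \<tau> + (2 * real l - 1) * L" using constants by linarith
    then have "lam * (2 * (\<tau> + (2 * real l - 1) * L)) < real l"
      using lambda by (simp add: pos_less_divide_eq)
    then have "\<tau> + (2 * real l - 1) * L < real l / (2 * lam)"
      using lam by (simp add: pos_less_divide_eq mult_ac)
    \<comment> \<open>Lowering \<open>2 l - 1\<close> to \<open>2 l - 3\<close> subtracts the
      positive quantity \<open>2 L\<close>.\<close>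
    then have "\<tau> + (2 * real l - 3) * L < real l / (2 * lam)"
      using constants by (simp add: algebra_simps)
    then show ?thesis using lam l by (simp add: r_def rssm.descent_rate_def)
  qed
  have \<gamma>: "0 < \<gamma> k" "\<gamma> k * L \<le> 1"
    using stepsizes[of k] constants by (auto simp: pos_less_divide_eq)
  show ?thesis
    using rssm.cond_exp_descent[of M \<F> \<gamma> X0 X D E k, OF run init \<gamma> r[unfolded r_def]] AE_space
  proof eventually_elim
    case (elim \<omega>)
    let ?X = "X k \<omega>"
    have Xk: "?X \<in> stiefel" by (rule rssm_run_in_stiefel[OF run init elim(2)])
    let ?q = "(avg_inv_norm \<CC> ?X (prox f \<CC> lam ?X - ?X))\<^sup>2"
    \<comment> \<open>\<open>prox\<close> selects one of the minimisers, so its gap is among those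
      under the supremum.\<close>
    have "?q \<le> rssm.worst_gap ?X"
      unfolding rssm.avg_inv_norm_sq[OF Xk] rssm.worst_gap_def
      by (rule cSUP_upper[OF rssm.prox_in_minimisers[OF Xk] rssm.bdd_above_gap[OF Xk]])
    then have "\<gamma> k / lam\<^sup>2 * ?q * r \<le> \<gamma> k / lam\<^sup>2 * rssm.worst_gap ?X * r"
      using \<gamma> r by (intro mult_right_mono mult_left_mono) auto
    also have "\<dots> \<le> envelope f \<CC> lam ?X
        - real_cond_exp M (vimage_algebra (space M) (X k) borel) (\<lambda>\<omega>'. envelope f \<CC> lam (X (Suc k) \<omega>')) \<omega>
        + rssm.descent_error (\<gamma> k)"
      using elim(1) by (simp add: r_def)
    finally have "\<gamma> k / lam\<^sup>2 * ?q \<le> (envelope f \<CC> lam ?X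
        - real_cond_exp M (vimage_algebra (space M) (X k) borel) (\<lambda>\<omega>'. envelope f \<CC> lam (X (Suc k) \<omega>')) \<omega>
        + rssm.descent_error (\<gamma> k)) / r"
      using r by (simp add: pos_le_divide_eq)
    then show ?case
      by (simp add: stationarity_measure_def power_mult_distrib power_divide rssm.descent_error_def r_def rssm.descent_rate_def add_ac)
  qed
qed

end
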